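(* Let $X$ be an equiangular set with angle $\frac15$ and base size $K(X)=5$ in $\mathbb{R}^r$, and consider the pillar decomposition of $X$ with respect to a fixed $5$-base $P=\{p_1,\dots,p_5\}$. (1) If there are two or more nonempty $(5,2)$ pillars, then $|X|\leq 272$. (2) If there is at most one nonempty $(5,2)$ pillar, then $|X|\leq \frac43 r+12$.
   Context: Equiangular set: a finite set $X=\{x_1,\dots,x_s\}$ of unit vectors in $\mathbb{R}^r$ is equiangular with angle $\alpha\in[0,1)$ if $\langle x_i,x_j\rangle\in\{-\alpha,\alpha\}$ for all $i\neq j$. Two sets of unit vectors are switching equivalent if one is obtained from the other by replacing some vectors by their negatives (and relabeling), i.e. they represent the same lines; correspondingly two Gram matrices satisfy $G\simeq G'$ if $G'=(CB)^{T}G(CB)$ with $B$ a diagonal $\pm1$ matrix and $C$ a permutation matrix. $I$ is the identity and $J$ the all-one matrix. Base size: $K(X)$ is the largest $k$ for which there are $p_1,\dots,p_k\in X$ whose Gram matrix satisfies $G(p_1,\dots,p_k)\simeq(1+\alpha)I-\alpha J$. A $K$-base of $X$ (with $K=K(X)$) is a set $P=\{p_1,\dots,p_K\}$ contained in some set switching equivalent to $X$ with $G(p_1,\dots,p_K)=(1+\alpha)I-\alpha J$ (so $\langle p_i,p_j\rangle=-\alpha$ for $i\ne j$). After switching one assumes $P\subset X$. Pillars with respect to $P$: for $x\in X\setminus P$ let $\varepsilon(x)\in\{1,-1\}^K$ be defined by $(\langle x,p_1\rangle,\dots,\langle x,p_K\rangle)=\alpha\,\varepsilon(x)$. Each $x\in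 X\setminus P$ is replaced by $-x$ if $\varepsilon(x)$ has more positive entries than $\varepsilon(-x)$, or if they have equally many positive entries and $\langle x,p_K\rangle=\alpha$; otherwise $x$ is kept. After this normalization, the pillar $\bar{x}$ of $x\in X\setminus P$ is the set of all $x'\in X\setminus P$ with $\varepsilon(x')=\varepsilon(x)$; it is called a $(K,m)$ pillar if $\varepsilon(x)$ has exactly $m$ positive entries. Thus for $K=5$, $X\setminus P$ is partitioned into at most $5$ $(5,1)$ pillars and at most $10$ $(5,2)$ pillars. *)

theory Defs
  imports
    "HOL-Analysis.Analysis"
    "HOL-Combinatorics.Permutations"
    "Jordan_Normal_Form.Matrix"
begin

definition equiangular :: "real \<Rightarrow> 'a::real_inner set \<Rightarrow> bool" where
  "equiangular \<alpha> X \<longleftrightarrow>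
     0 \<le> \<alpha> \<and> \<alpha> < 1 \<and> finite X \<and> (\<forall>x\<in>X. norm x = 1) \<and>
     (\<forall>x\<in>X. \<forall>y\<in>X. x \<noteq> y \<longrightarrow> inner x y \<in> {-\<alpha>, \<alpha>})"

definition switching_equivalent :: "'a::real_inner set \<Rightarrow> 'a set \<Rightarrow> bool" where
  "switching_equivalent X Y \<longleftrightarrow> (\<exists>s. (\<forall>x\<in>X. s x \<in> {x, -x}) \<and> bij_betw s X Y)"

definition gram :: "'a::real_inner list \<Rightarrow> real mat" where
  "gram ps = Matrix.mat (length ps) (length ps) (\<lambda>(i, j). inner (ps ! i) (ps ! j))"

definition perm_matrix :: "nat \<Rightarrow> (nat \<Rightarrow> nat) \<Rightarrow> real mat" where
  "perm_matrix k \<pi> = Matrix.mat k k (\<lambda>(i, j). if i = \<pi> j then 1 else 0)"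

text \<open>For square matrices of size \<open>k\<close>: \<open>G' = (C B)\<^sup>T G (C B)\<close> with \<open>B\<close> a diagonal sign matrix
  and \<open>C\<close> a permutation matrix.\<close>
definition gram_equivalent :: "nat \<Rightarrow> real mat \<Rightarrow> real mat \<Rightarrow> bool" where
  "gram_equivalent k G G' \<longleftrightarrow>
     (\<exists>b \<pi>. (\<forall>i<k. b i \<in> {-1, 1}) \<and> \<pi> permutes {..<k} \<and>
        (let C = perm_matrix k \<pi>; B = mat_diag k b
         in G' = transpose_mat (C * B) * G * (C * B)))"

text \<open>The matrix \<open>(1 + \<alpha>) I - \<alpha> J\<close> of size \<open>k\<close>, with \<open>J\<close> the all-one matrix.\<close>
definition base_gram :: "real \<Rightarrow> nat \<Rightarrow> real mat" where
  "base_gram \<alpha> k = (1 + \<alpha>) \<cdot>\<^sub>m 1\<^sub>m k - \<alpha> \<cdot>\<^sub>m Matrix.mat k k (\<lambda>_. 1)"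

text \<open>The maximum exists when \<open>X\<close> is equiangular: \<open>k = 0\<close> qualifies, and since the entries
  off the diagonal of the Gram matrix are not \<open>1\<close>, the vectors in such a list are distinct,
  whence \<open>k \<le> card X\<close>.\<close>
definition base_size :: "real \<Rightarrow> 'a::real_inner set \<Rightarrow> nat" where
  "base_size \<alpha> X =
     Max {k. \<exists>ps. length ps = k \<and> set ps \<subseteq> X \<and> gram_equivalent k (gram ps) (base_gram \<alpha> k)}"

text \<open>A \<open>K\<close>-base is kept as a list, since sign patterns refer to its enumeration.\<close>
definition is_base :: "real \<Rightarrow> 'a::real_inner set \<Rightarrow> 'a list \<Rightarrow> bool" where
  "is_base \<alpha> X ps \<longleftrightarrow>
     length ps = base_size \<alpha> X \<and>
     (\<exists>Y. switching_equivalent X Y \<and> set ps \<subseteq> Y) \<and>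
     gram ps = base_gram \<alpha> (length ps)"

text \<open>Switch \<open>X\<close> so that it contains \<open>P\<close>: the vectors of \<open>X\<close> whose negatives lie in \<open>P\<close> are
  negated, the others are left alone.  If \<open>P\<close> is already a subset of the equiangular set \<open>X\<close>,
  then \<open>X\<close> does not change.\<close>
definition switch_onto :: "'a::real_inner set \<Rightarrow> 'a set \<Rightarrow> 'a set" where
  "switch_onto P X = (\<lambda>x. if -x \<in> P then -x else x) ` X"

text \<open>The sign vector \<open>\<epsilon>(x)\<close>, where \<open>\<langle>x, p\<^sub>i\<rangle> = \<alpha> \<epsilon>(x)\<^sub>i\<close>; meaningful for \<open>\<alpha> \<noteq> 0\<close>.\<close>
definition signs :: "real \<Rightarrow> 'a::real_inner list \<Rightarrow> 'a \<Rightarrow> real list" where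
  "signs \<alpha> ps x = map (\<lambda>p. inner x p / \<alpha>) ps"

definition num_pos :: "real list \<Rightarrow> nat" where
  "num_pos e = length (filter (\<lambda>t. t > 0) e)"

definition normalize_sign :: "real \<Rightarrow> 'a::real_inner list \<Rightarrow> 'a \<Rightarrow> 'a" where
  "normalize_sign \<alpha> ps x =
     (if num_pos (signs \<alpha> ps x) > num_pos (signs \<alpha> ps (-x)) \<or>
         num_pos (signs \<alpha> ps x) = num_pos (signs \<alpha> ps (-x)) \<and> inner x (last ps) = \<alpha>
      then -x else x)"

text \<open>The set \<open>X - P\<close> after switching and normalization.\<close>
definition normalized_rest :: "real \<Rightarrow> 'a::real_inner set \<Rightarrow> 'a list \<Rightarrow> 'a set" where
  "normalized_rest \<alpha> X ps = normalize_sign \<alpha> ps ` (switch_onto (set ps) X - set ps)"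

definition pillar :: "real \<Rightarrow> 'a::real_inner set \<Rightarrow> 'a list \<Rightarrow> 'a \<Rightarrow> 'a set" where
  "pillar \<alpha> X ps x = {x' \<in> normalized_rest \<alpha> X ps. signs \<alpha> ps x' = signs \<alpha> ps x}"

text \<open>The \<open>(K, m)\<close> pillars, \<open>K\<close> being the length of \<open>ps\<close>.  Each of them contains the vector
  defining it, so this is the set of nonempty \<open>(K, m)\<close> pillars.\<close>
definition pillars :: "real \<Rightarrow> 'a::real_inner set \<Rightarrow> 'a list \<Rightarrow> nat \<Rightarrow> 'a set set" where
  "pillars \<alpha> X ps m =
     {pillar \<alpha> X ps x | x. x \<in> normalized_rest \<alpha> X ps \<and> num_pos (signs \<alpha> ps x) = m}"

end

theory Submission
  imports Defs
begin

text \<open>Let \<open>q\<close> be the orthogonal projection along the span of the base \<open>P = {p\<^sub>1, \<dots>, p\<^sub>5}\<close>.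
Since the inner products with \<open>P\<close> are prescribed by the sign vectors, \<open>\<langle>q x, q y\<rangle>\<close> depends
only on \<open>\<langle>x, y\<rangle> = \<plusminus>1/5\<close> and on the pillars of \<open>x\<close> and \<open>y\<close>. No sign vector is entirely
negative, because such an \<open>x\<close> would extend \<open>P\<close> to six vectors with all inner products
\<open>-1/5\<close>.

The projections of the vectors in the \<open>(5,1)\<close> pillars have squared norm \<open>8/15\<close> and pairwise
inner products at most \<open>-2/15\<close>, so there are at most five of them, in all pillars together.

The projections of a \<open>(5,2)\<close> pillar, rescaled to squared norm \<open>2\<close>, have pairwise inner
products in \<open>{0, -1}\<close>: they look like the nodes of a simply laced (possibly affine) Dynkin
diagram. This diagram has no triangle, since a triangle together with the three base vectors
of negative sign would again be a base of size six. The affine diagram of largest ratio of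
nodes to rank is then the 4-cycle, with ratio \<open>4/3\<close>; this gives part (2).

For part (1), vectors of different \<open>(5,2)\<close> pillars have (up to a global sign of one of the
pillars) rescaled inner products in \<open>{1/3, -2/3}\<close>. If \<open>b\<close> lies in the one and \<open>T\<close> is the set
of those vectors of the other pillar \<open>A\<close> that have product \<open>-2/3\<close> with \<open>b\<close>, then
\<open>|3b + \<Sum>T|\<^sup>2 \<le> 18 - 2|T|\<close>. Hence \<open>|T| \<le> 9\<close>, and when equality holds \<open>3b = -\<Sum>T\<close> and \<open>T\<close> is a
perfect code in the diagram of \<open>A\<close>. As the products average out to nearly \<open>0\<close>, roughly a
third of \<open>A\<close> lies in \<open>T\<close>, so that two large pillars have about \<open>27\<close> vectors each at most.
Subtracting a suitable fixed vector from all \<open>3b + \<Sum>T\<close> before squaring and adding turns this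
heuristic into the quadratic inequality \<open>defect_inequality\<close>. Combined with the bound
\<open>\<Sum>\<^sub>a \<langle>v, a\<rangle>\<^sup>2 \<le> 4|v|\<^sup>2\<close>, it excludes sizes \<open>(29, 25)\<close>, and for sizes \<open>(27, 27)\<close> it forces
all the estimates to be equalities: \<open>A\<close> is then a union of cycles, every \<open>T\<close> is a perfect
code, and in a triangle-free 2-regular graph a perfect code containing a vertex contains
each vertex at the end of a path of length three from it. Nine vectors \<open>b\<close> that agree on two
vertices in this way contradict the Cauchy-Schwarz inequality. So at most one pillar has
more than \<open>26\<close> vectors. Should it have at least \<open>29\<close> (it never has more than \<open>45\<close>), then the
other ones have at most \<open>24\<close>. In every case the at most ten \<open>(5,2)\<close> pillars have at most
\<open>262\<close> vectors, and \<open>262 + 5 + 5 = 272\<close>.\<close>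

section \<open>Simply laced sets of vectors\<close>

text \<open>Nodes of a simply laced Dynkin diagram, finite or affine: inner product \<open>-1\<close> means
that two nodes are joined by an edge. Linear dependence is permitted, as the nodes of an
affine diagram are dependent.\<close>
definition simply_laced :: "'a::real_inner set \<Rightarrow> bool" where
  "simply_laced A \<longleftrightarrow> finite A \<and> (\<forall>a\<in>A. inner a a = 2) \<and>
     (\<forall>a\<in>A. \<forall>b\<in>A. a \<noteq> b \<longrightarrow> inner a b \<in> {0, -1})"

definition triangle_free :: "'a::real_inner set \<Rightarrow> bool" where
  "triangle_free A \<longleftrightarrow>
     (\<forall>a\<in>A. \<forall>b\<in>A. \<forall>c\<in>A. \<not> (inner a b = -1 \<and> inner b c = -1 \<and> inner a c = -1))"

lemma simply_lacedD:
  assumes "simply_laced A"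
  shows "finite A" "\<And>a. a \<in> A \<Longrightarrow> inner a a = 2"
    "\<And>a b. a \<in> A \<Longrightarrow> b \<in> A \<Longrightarrow> a \<noteq> b \<Longrightarrow> inner a b = 0 \<or> inner a b = -1"
  using assms unfolding simply_laced_def by auto

lemma simply_laced_subset: "simply_laced A \<Longrightarrow> B \<subseteq> A \<Longrightarrow> simply_laced B"
  unfolding simply_laced_def by (meson finite_subset subsetD)

lemma triangle_free_subset: "triangle_free A \<Longrightarrow> B \<subseteq> A \<Longrightarrow> triangle_free B"
  unfolding triangle_free_def by (meson subsetD)

text \<open>In a linear relation between pairwise non-acute vectors, the positive part equals the
negation of the negative part; the inner product of these two is \<open>\<le> 0\<close>, so each of them
vanishes by itself.\<close>
lemma nonneg_relation:
  fixes S :: "'a::real_inner set"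
  assumes fin: "finite S" and dep: "dependent S"
    and obt: "\<And>x y. x \<in> S \<Longrightarrow> y \<in> S \<Longrightarrow> x \<noteq> y \<Longrightarrow> inner x y \<le> 0"
  obtains T c where "T \<subseteq> S" "T \<noteq> {}" "\<forall>t\<in>T. c t > (0::real)" "(\<Sum>t\<in>T. c t *\<^sub>R t) = 0"
proof -
  obtain u v where v: "v \<in> S" "u v \<noteq> 0" and rel: "(\<Sum>v\<in>S. u v *\<^sub>R v) = 0"
    using dep fin by (auto simp: dependent_finite)
  define P where "P = {v\<in>S. u v > 0}"
  define N where "N = {v\<in>S. u v < 0}"
  define w where "w = (\<Sum>v\<in>P. u v *\<^sub>R v)"
  have "(\<Sum>v\<in>S. u v *\<^sub>R v) = (\<Sum>v\<in>P \<union> N. u v *\<^sub>R v)"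
    by (rule sum.mono_neutral_right) (auto simp: P_def N_def fin)
  also have "\<dots> = w + (\<Sum>v\<in>N. u v *\<^sub>R v)"
    unfolding w_def by (rule sum.union_disjoint) (auto simp: P_def N_def fin)
  finally have wN: "w = (\<Sum>v\<in>N. (- u v) *\<^sub>R v)"
    using rel by (simp add: sum_negf eq_neg_iff_add_eq_0)
  have "inner w w = (\<Sum>x\<in>P. \<Sum>y\<in>N. u x * (- u y) * inner x y)"
    by (subst (2) wN, subst w_def, subst inner_sum_left, subst inner_sum_right)
       (simp add: mult_ac)
  also have "\<dots> \<le> 0"
    by (intro sum_nonpos mult_nonneg_nonpos) (auto simp: P_def N_def intro!: obt mult_nonneg_nonpos mult_nonneg_nonneg)
  finally have w0: "w = 0"
    by (metis inner_ge_zero inner_eq_zero_iff order_antisym)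
  show thesis
  proof (cases "P = {}")
    case False
    show thesis
      by (rule that[of P u]) (use False w0 in \<open>auto simp: P_def w_def\<close>)
  next
    case True
    with v have "N \<noteq> {}" by (auto simp: P_def N_def neq_iff)
    then show thesis
      by (intro that[of N "\<lambda>v. - u v"]) (use wN w0 in \<open>auto simp: N_def\<close>)
  qed
qed

text \<open>A relation with positive coefficients makes twice the coefficient of a node the sum of
the coefficients of its neighbours. So a node \<open>t\<close> of maximal coefficient has at least two
neighbours. If these were the only further nodes, they would, for lack of triangles, be
adjacent to \<open>t\<close> alone, and \<open>2 c\<^sub>t = c\<^sub>t/2 + c\<^sub>t/2\<close>.\<close>
lemma relation_support_ge_4:
  fixes T :: "'a::real_inner set"
  assumes T: "simply_laced T" "triangle_free T" "T \<noteq> {}"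
    and c: "\<forall>t\<in>T. c t > (0::real)" and rel: "(\<Sum>t\<in>T. c t *\<^sub>R t) = 0"
  shows "card T \<ge> 4"
proof (rule ccontr)
  assume "\<not> ?thesis"
  then have le3: "card T \<le> 3" by simp
  note rs = simply_lacedD[OF T(1)]
  define nb where "nb t = {s\<in>T. inner s t = -1}" for t
  have bal: "2 * c t = (\<Sum>s\<in>nb t. c s)" if t: "t \<in> T" for t
  proof -
    have "0 = (\<Sum>s\<in>T. c s * inner s t)"
      using arg_cong[OF rel, of "\<lambda>v. inner v t"] by (simp add: inner_sum_left)
    also have "\<dots> = (\<Sum>s\<in>T. (if s = t then 2 * c s else 0) + (if inner s t = -1 then - c s else 0))"
      by (rule sum.cong[OF refl]) (use rs t in \<open>fastforce\<close>)
    also have "\<dots> = 2 * c t - (\<Sum>s\<in>nb t. c s)"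
      using rs(1) t
      by (simp add: sum.distrib nb_def sum.inter_filter[symmetric] sum_negf)
    finally show ?thesis by simp
  qed
  have "Max (c ` T) \<in> c ` T" using rs(1) T(3) by simp
  then obtain t where t: "t \<in> T" and "c t = Max (c ` T)" by auto
  then have max: "c s \<le> c t" if "s \<in> T" for s using rs(1) that by simp
  have "2 * c t \<le> real (card (nb t)) * c t"
    using bal[OF t] sum_bounded_above[of "nb t" c "c t"] max by (auto simp: nb_def)
  then have "card (nb t) \<ge> 2" using c t by fastforce
  then obtain R where R: "R \<subseteq> nb t" "card R = 2" by (meson obtain_subset_with_card_n)
  then obtain s r where sr: "s \<noteq> r" "s \<in> nb t" "r \<in> nb t"
    by (auto simp: card_2_iff)
  have tn: "t \<notin> nb t" using rs(2)[OF t] by (simp add: nb_def)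
  have mem: "s \<in> T" "r \<in> T" "t \<noteq> s" "t \<noteq> r" using sr tn by (auto simp: nb_def)
  have "card {t, s, r} = 3" using mem(3,4) sr(1) by simp
  then have Teq: "T = {t, s, r}"
    using card_seteq[OF rs(1), of "{t, s, r}"] le3 mem(1,2) t by simp
  have ip: "inner s t = -1" "inner r t = -1" "inner t t = 2" "inner s s = 2" "inner r r = 2"
    using sr(2,3) t mem(1,2) rs(2) by (auto simp: nb_def)
  have "\<not> (inner s t = -1 \<and> inner t r = -1 \<and> inner s r = -1)"
    using T(2) t mem(1,2) unfolding triangle_free_def by blast
  then have ip': "inner s r \<noteq> -1" "inner r s \<noteq> -1" "inner t s = -1" "inner t r = -1"
    using ip(1,2) by (simp_all add: inner_commute)
  have 1: "nb s = {t}" and 2: "nb r = {t}" and 3: "nb t = {s, r}"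
    unfolding nb_def Teq using ip ip' by auto
  have "c t = 0"
    using bal[OF t] bal[OF mem(1)] bal[OF mem(2)] sr(1) by (simp add: 1 2 3)
  then show False using c t by force
qed

text \<open>The support \<open>T\<close> of a minimal positive relation spans a space of dimension \<open>|T| - 1\<close>
with \<open>|T| \<ge> 4\<close>, and it is orthogonal to all other nodes, because these are non-acute to each
vector in \<open>T\<close>. So \<open>T\<close> can be split off without appeal to the classification of Dynkin
diagrams.\<close>
lemma triangle_free_simply_laced_card:
  fixes S :: "'a::euclidean_space set"
  assumes "simply_laced S" "triangle_free S"
  shows "3 * card S \<le> 4 * dim S"
  using assms
proof (induction "card S" arbitrary: S rule: less_induct)
  case less
  note rs = simply_lacedD[OF less.prems(1)]
  have obt: "inner x y \<le> 0" if "x \<in> S" "y \<in> S" "x \<noteq> y" for x y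
    using rs(3)[OF that] by auto
  show ?case
  proof (cases "dependent S")
    case False
    then have "dim S = card S" by (rule dim_eq_card_independent)
    then show ?thesis by simp
  next
    case True
    define rel where "rel T \<longleftrightarrow> T \<subseteq> S \<and> T \<noteq> {} \<and>
      (\<exists>c. (\<forall>t\<in>T. c t > (0::real)) \<and> (\<Sum>t\<in>T. c t *\<^sub>R t) = 0)" for T
    have "\<exists>T. rel T"
      by (rule nonneg_relation[OF rs(1) True obt]) (auto simp: rel_def)
    then obtain T where T: "rel T" and min: "\<And>T'. rel T' \<Longrightarrow> card T \<le> card T'"
      using ex_has_least_nat[of rel _ card] by blast
    obtain c where TS: "T \<subseteq> S" "T \<noteq> {}" and c: "\<forall>t\<in>T. c t > (0::real)"
      and r0: "(\<Sum>t\<in>T. c t *\<^sub>R t) = 0" using T unfolding rel_def by auto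
    have finT: "finite T" using TS rs(1) finite_subset by blast
    obtain t0 where t0: "t0 \<in> T" using TS by auto
    have "independent (T - {t0})"
    proof
      assume d: "dependent (T - {t0})"
      obtain T' where "T' \<subseteq> T - {t0}" "rel T'"
      proof (rule nonneg_relation[OF _ d])
        show "finite (T - {t0})" using finT by simp
        show "\<And>x y. x \<in> T - {t0} \<Longrightarrow> y \<in> T - {t0} \<Longrightarrow> x \<noteq> y \<Longrightarrow> inner x y \<le> 0"
          using obt TS by blast
        fix T' c' assume "T' \<subseteq> T - {t0}" "T' \<noteq> {}" "\<forall>t\<in>T'. c' t > (0::real)"
          "(\<Sum>t\<in>T'. c' t *\<^sub>R t) = 0"
        then show thesis using that TS unfolding rel_def by blast
      qed
      moreover have "card T' < card T"
        using \<open>T' \<subseteq> T - {t0}\<close> finT t0 by (intro psubset_card_mono) auto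
      ultimately show False using min by fastforce
    qed
    then have "card (T - {t0}) \<le> dim T"
      by (intro independent_card_le_dim) auto
    then have dT: "card T \<le> dim T + 1" using t0 finT by simp
    have c4: "card T \<ge> 4"
      using relation_support_ge_4[OF simply_laced_subset[OF less.prems(1) TS(1)]
          triangle_free_subset[OF less.prems(2) TS(1)] TS(2) c r0] .
    have orth: "inner x y = 0" if "x \<in> T" "y \<in> S - T" for x y
    proof -
      have "(\<Sum>t\<in>T. - (c t * inner t y)) = 0"
        using arg_cong[OF r0, of "\<lambda>v. inner v y"] by (simp add: inner_sum_left sum_negf)
      moreover have "\<forall>t\<in>T. 0 \<le> - (c t * inner t y)"
        using c obt that TS by (smt (verit) DiffD1 DiffD2 mult_nonneg_nonpos subsetD)
      ultimately have "- (c x * inner x y) = 0"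
        using sum_nonneg_eq_0_iff[OF finT, of "\<lambda>t. - (c t * inner t y)"] that by blast
      then show ?thesis using c that by force
    qed
    have "dim (T \<union> (S - T)) = dim T + dim (S - T)"
      using orth by (rule dim_orthogonal_sum)
    moreover have "T \<union> (S - T) = S" using TS by auto
    moreover have "card S = card T + card (S - T)"
      using TS finT rs(1) card_mono by (metis card_Diff_subset le_add_diff_inverse)
    moreover have "3 * card (S - T) \<le> 4 * dim (S - T)"
      using calculation(3) c4
      by (intro less.hyps simply_laced_subset[OF less.prems(1)] triangle_free_subset[OF less.prems(2)]) auto
    ultimately show ?thesis using dT c4 by simp
  qed
qed

text \<open>The adjacency matrix is at most \<open>2\<close> because the Gram matrix is positive semidefinite.
Being nonnegative, it is also at least \<open>-2\<close>, so that the Gram matrix is at most \<open>4\<close>. The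
proof compares the coefficients with their absolute values.\<close>
lemma simply_laced_combination_norm:
  assumes A: "simply_laced A"
  shows "inner (\<Sum>a\<in>A. f a *\<^sub>R a) (\<Sum>a\<in>A. f a *\<^sub>R a) \<le> 4 * (\<Sum>a\<in>A. (f a)\<^sup>2)"
proof -
  note rs = simply_lacedD[OF A]
  have expand: "inner (\<Sum>a\<in>A. g a *\<^sub>R a) (\<Sum>a\<in>A. g a *\<^sub>R a) = (\<Sum>a\<in>A. \<Sum>b\<in>A. g a * g b * inner a b)"
    for g :: "'a \<Rightarrow> real"
    by (subst inner_sum_left, subst inner_sum_right) (simp add: mult_ac)
  have pair: "f a * f b * inner a b + \<bar>f a\<bar> * \<bar>f b\<bar> * inner a b \<le> (if a = b then 4 * (f a)\<^sup>2 else 0)"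
    if ab: "a \<in> A" "b \<in> A" for a b
  proof (cases "a = b")
    case True
    have "\<bar>f b\<bar> * \<bar>f b\<bar> = f b * f b" by simp
    then show ?thesis using True rs(2)[OF ab(2)] by (simp add: power2_eq_square)
  next
    case False
    have "0 \<le> f a * f b + \<bar>f a\<bar> * \<bar>f b\<bar>"
      by (metis abs_mult abs_ge_minus_self add.commute add_increasing2 minus_le_iff
          neg_le_iff_le abs_ge_self diff_ge_0_iff_ge diff_minus_eq_add)
    then show ?thesis using rs(3)[OF ab False] False by auto
  qed
  have "0 \<le> inner (\<Sum>a\<in>A. \<bar>f a\<bar> *\<^sub>R a) (\<Sum>a\<in>A. \<bar>f a\<bar> *\<^sub>R a)" by simp
  then have "inner (\<Sum>a\<in>A. f a *\<^sub>R a) (\<Sum>a\<in>A. f a *\<^sub>R a)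
      \<le> (\<Sum>a\<in>A. \<Sum>b\<in>A. f a * f b * inner a b + \<bar>f a\<bar> * \<bar>f b\<bar> * inner a b)"
    by (simp add: expand sum.distrib)
  also have "\<dots> \<le> (\<Sum>a\<in>A. \<Sum>b\<in>A. if a = b then 4 * (f a)\<^sup>2 else 0)"
    by (intro sum_mono pair)
  also have "\<dots> = 4 * (\<Sum>a\<in>A. (f a)\<^sup>2)"
    using rs(1) by (simp add: sum_distrib_left)
  finally show ?thesis .
qed

text \<open>Dual form of the preceding bound: the frame operator \<open>v \<mapsto> \<Sum>\<^sub>a \<langle>v, a\<rangle> a\<close> has the same
largest eigenvalue as the Gram matrix.\<close>
lemma simply_laced_frame_bound:
  assumes A: "simply_laced A"
  shows "(\<Sum>a\<in>A. (inner v a)\<^sup>2) \<le> 4 * inner v v"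
proof -
  define Q where "Q = (\<Sum>a\<in>A. (inner v a)\<^sup>2)"
  define s where "s = (\<Sum>a\<in>A. inner v a *\<^sub>R a)"
  have vs: "inner v s = Q"
    by (simp add: s_def Q_def inner_sum_right power2_eq_square)
  have "inner s s \<le> 4 * Q"
    unfolding s_def Q_def by (rule simply_laced_combination_norm[OF A])
  moreover have "Q\<^sup>2 \<le> inner v v * inner s s"
    using Cauchy_Schwarz_ineq[of v s] vs by simp
  ultimately have "Q\<^sup>2 \<le> inner v v * (4 * Q)"
    by (meson inner_ge_zero mult_left_mono order_trans)
  moreover have "Q \<ge> 0" unfolding Q_def by (simp add: sum_nonneg)
  ultimately show ?thesis unfolding Q_def[symmetric]
    by (cases "Q = 0") (auto simp: power2_eq_square)
qed

lemma simply_laced_sum_norm: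
  assumes A: "simply_laced A"
  shows "inner (\<Sum>A) (\<Sum>A) \<le> 2 * real (card A)"
proof -
  note rs = simply_lacedD[OF A]
  have "inner (\<Sum>A) (\<Sum>A) = (\<Sum>a\<in>A. \<Sum>b\<in>A. inner a b)"
    by (subst inner_sum_left, subst inner_sum_right) simp
  also have "\<dots> \<le> (\<Sum>a\<in>A. \<Sum>b\<in>A. if a = b then 2 else 0)"
  proof (intro sum_mono)
    fix a b assume "a \<in> A" "b \<in> A"
    then show "inner a b \<le> (if a = b then 2 else 0)"
      using rs(2)[of a] rs(3)[of a b] by (cases "a = b") auto
  qed
  also have "\<dots> = 2 * real (card A)" using rs(1) by simp
  finally show ?thesis .
qed

section \<open>Two coupled sets\<close>

text \<open>The relation between the rescaled projections of two different \<open>(5,2)\<close> pillars, after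
one of them has been negated if necessary.\<close>
definition coupled :: "'a::real_inner set \<Rightarrow> 'a set \<Rightarrow> bool" where
  "coupled A B \<longleftrightarrow> simply_laced A \<and> simply_laced B \<and> (\<forall>a\<in>A. \<forall>b\<in>B. inner a b \<in> {1/3, -2/3})"

definition low :: "'a::real_inner set \<Rightarrow> 'a \<Rightarrow> 'a set" where
  "low A b = {a\<in>A. inner a b = -2/3}"

lemma coupledD:
  assumes "coupled A B"
  shows "simply_laced A" "simply_laced B"
    "\<And>a b. a \<in> A \<Longrightarrow> b \<in> B \<Longrightarrow> inner a b = (if a \<in> low A b then -2/3 else 1/3)"
  using assms unfolding coupled_def low_def by auto

lemma coupled_sym: "coupled A B \<Longrightarrow> coupled B A"
  unfolding coupled_def by (subst (asm) inner_commute) blast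

lemma coupled_subset: "coupled A B \<Longrightarrow> A' \<subseteq> A \<Longrightarrow> B' \<subseteq> B \<Longrightarrow> coupled A' B'"
  unfolding coupled_def using simply_laced_subset by blast

text \<open>In an ideal configuration \<open>3b = -\<Sum>(low A b)\<close>. The defect from this bounds the size of
\<open>low A b\<close> by \<open>9\<close>, and it is the quantity that all later estimates add up over \<open>b\<close>.\<close>
lemma low_norm:
  assumes AB: "coupled A B" and b: "b \<in> B"
  shows "inner (3 *\<^sub>R b + \<Sum>(low A b)) (3 *\<^sub>R b + \<Sum>(low A b)) \<le> 18 - 2 * real (card (low A b))"
proof -
  let ?T = "low A b"
  have "inner b (\<Sum>?T) = (\<Sum>a\<in>?T. -2/3)"
    unfolding inner_sum_right by (rule sum.cong) (auto simp: low_def inner_commute)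
  then have 1: "inner b (\<Sum>?T) = - (2/3) * real (card ?T)" by simp
  have "simply_laced ?T"
    using coupledD(1)[OF AB] by (rule simply_laced_subset) (auto simp: low_def)
  then have 2: "inner (\<Sum>?T) (\<Sum>?T) \<le> 2 * real (card ?T)" by (rule simply_laced_sum_norm)
  have 3: "inner b b = 2" using simply_lacedD(2)[OF coupledD(2)[OF AB] b] .
  show ?thesis
    using 1 2 3 by (simp add: inner_add_left inner_add_right inner_commute[of "\<Sum>?T" b])
qed

lemma card_low_le: assumes "coupled A B" "b \<in> B" shows "card (low A b) \<le> 9"
proof -
  have "0 \<le> 18 - 2 * real (card (low A b))"
    using low_norm[OF assms] inner_ge_zero order_trans by blast
  then show ?thesis by simp
qed

text \<open>There are at most \<open>9\<close> vectors with inner product \<open>-2/3\<close>. At most \<open>36\<close> vectors can have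
the inner product \<open>1/3\<close>, since \<open>6b\<close> minus their sum has nonnegative squared norm.\<close>
lemma card_coupled_le_45:
  assumes AB: "coupled A B" and b: "b \<in> B"
  shows "card A \<le> 45"
proof -
  let ?F = "A - low A b"
  note rs = simply_lacedD[OF coupledD(1)[OF AB]]
  have F: "simply_laced ?F" using coupledD(1)[OF AB] by (rule simply_laced_subset) auto
  have "inner b (\<Sum>?F) = (\<Sum>a\<in>?F. 1/3)"
    unfolding inner_sum_right using coupledD(3)[OF AB _ b] by (intro sum.cong) (auto simp: inner_commute)
  then have 1: "inner b (\<Sum>?F) = (1/3) * real (card ?F)" by simp
  have 2: "inner (\<Sum>?F) (\<Sum>?F) \<le> 2 * real (card ?F)" using F by (rule simply_laced_sum_norm)
  have 3: "inner b b = 2" using simply_lacedD(2)[OF coupledD(2)[OF AB] b] .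
  have "0 \<le> inner (6 *\<^sub>R b - \<Sum>?F) (6 *\<^sub>R b - \<Sum>?F)" by simp
  then have "card ?F \<le> 36"
    using 1 2 3 by (simp add: inner_diff_left inner_diff_right inner_commute[of "\<Sum>?F" b])
  moreover have "card A = card ?F + card (low A b)"
    using rs(1) by (metis (no_types, lifting) add.commute card_Diff_subset card_mono finite_subset
        le_add_diff_inverse low_def mem_Collect_eq subsetI)
  ultimately show ?thesis using card_low_le[OF AB b] by simp
qed

lemma inner_sum_coupled:
  assumes AB: "coupled A B" and a: "a \<in> A"
  shows "inner (\<Sum>B) a = real (card B) / 3 - real (card (low B a))"
proof -
  have fB: "finite B" using simply_lacedD(1)[OF coupledD(2)[OF AB]] .
  have "inner (\<Sum>B) a = (\<Sum>b\<in>B. 1/3 - (if b \<in> low B a then 1 else 0))"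
    unfolding inner_sum_left
    by (rule sum.cong[OF refl]) (use coupledD(3)[OF coupled_sym[OF AB] _ a] in auto)
  also have "\<dots> = real (card B) / 3 - real (card (low B a))"
  proof -
    have "B \<inter> {b. b \<in> low B a} = low B a" by (auto simp: low_def)
    then show ?thesis using fB by (simp add: sum_subtractf sum.If_cases)
  qed
  finally show ?thesis .
qed

text \<open>For \<open>u\<^sub>b = 3b + \<Sum>(low A b)\<close> the sum of all \<open>|u\<^sub>b - s|\<^sup>2\<close> is nonnegative. On the
right-hand side, \<open>|u\<^sub>b|\<^sup>2\<close> has been estimated by \<open>low_norm\<close>, and \<open>\<Sum>\<^sub>b u\<^sub>b\<close> has been
expressed by the sums of \<open>A\<close> and \<open>B\<close> and the frame operator of \<open>A\<close>, by counting for every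
\<open>a\<close> how often it occurs in \<open>low A b\<close>. The vector \<open>s\<close> is a free parameter.\<close>
lemma defect_inequality:
  assumes AB: "coupled A B"
  defines "n \<equiv> real (card A)" and "m \<equiv> real (card B)"
  shows "0 \<le> m * (18 - 2 * n / 3) + 2 * inner (\<Sum>A) (\<Sum>B)
    - 2 * inner (3 *\<^sub>R \<Sum>B + (m / 3) *\<^sub>R \<Sum>A - (\<Sum>a\<in>A. inner (\<Sum>B) a *\<^sub>R a)) s + m * inner s s"
proof -
  have fA: "finite A" and fB: "finite B"
    using simply_lacedD(1) coupledD(1,2)[OF AB] by auto
  define u where "u b = 3 *\<^sub>R b + \<Sum>(low A b)" for b
  define h where "h = (\<Sum>b\<in>B. real (card (low A b)))"
  have cnt: "inner (\<Sum>A) (\<Sum>B) = n * m / 3 - h"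
  proof -
    have "inner (\<Sum>A) (\<Sum>B) = (\<Sum>b\<in>B. inner (\<Sum>A) b)" by (simp add: inner_sum_right)
    also have "\<dots> = (\<Sum>b\<in>B. n / 3 - real (card (low A b)))"
      by (rule sum.cong[OF refl]) (use inner_sum_coupled[OF coupled_sym[OF AB]] in \<open>simp add: n_def\<close>)
    finally show ?thesis by (simp add: sum_subtractf h_def m_def)
  qed
  have "(\<Sum>b\<in>B. \<Sum>(low A b)) = (\<Sum>b\<in>B. \<Sum>a\<in>A. if inner a b = -2/3 then a else 0)"
    unfolding low_def using fA by (simp add: sum.inter_filter)
  also have "\<dots> = (\<Sum>a\<in>A. \<Sum>b\<in>B. if inner a b = -2/3 then a else 0)" by (rule sum.swap)
  also have "\<dots> = (\<Sum>a\<in>A. real (card (low B a)) *\<^sub>R a)"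
  proof (rule sum.cong[OF refl])
    fix a
    have "(\<Sum>b\<in>B. if inner a b = -2/3 then a else 0) = (\<Sum>b\<in>low B a. a)"
      unfolding low_def using fB by (simp add: sum.inter_filter inner_commute)
    then show "(\<Sum>b\<in>B. if inner a b = -2/3 then a else 0) = real (card (low B a)) *\<^sub>R a"
      by (simp add: sum_constant_scaleR)
  qed
  also have "\<dots> = (\<Sum>a\<in>A. (m / 3) *\<^sub>R a - inner (\<Sum>B) a *\<^sub>R a)"
    by (rule sum.cong[OF refl]) (simp add: inner_sum_coupled[OF AB] m_def algebra_simps)
  finally have U: "(\<Sum>b\<in>B. u b) = 3 *\<^sub>R \<Sum>B + (m / 3) *\<^sub>R \<Sum>A - (\<Sum>a\<in>A. inner (\<Sum>B) a *\<^sub>R a)"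
    by (simp add: u_def sum.distrib sum_subtractf scaleR_sum_right)
  have sq: "inner (u b - s) (u b - s) = inner (u b) (u b) - 2 * inner (u b) s + inner s s" for b
    by (simp add: inner_diff_left inner_diff_right inner_commute)
  have "0 \<le> (\<Sum>b\<in>B. inner (u b - s) (u b - s))" by (simp add: sum_nonneg)
  also have "\<dots> = (\<Sum>b\<in>B. inner (u b) (u b)) - 2 * inner (\<Sum>b\<in>B. u b) s + m * inner s s"
    by (simp add: sq sum.distrib sum_subtractf inner_sum_left sum_distrib_left m_def)
  also have "(\<Sum>b\<in>B. inner (u b) (u b)) \<le> (\<Sum>b\<in>B. 18 - 2 * real (card (low A b)))"
    by (rule sum_mono) (use low_norm[OF AB] in \<open>simp add: u_def\<close>)
  also have "(\<Sum>b\<in>B. 18 - 2 * real (card (low A b))) = 18 * m - 2 * h"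
    by (simp add: sum_subtractf h_def sum_distrib_left m_def)
  finally show ?thesis unfolding U using cnt by (simp add: algebra_simps)
qed

lemma inner_frame: "inner (\<Sum>a\<in>A. inner v a *\<^sub>R a) w = (\<Sum>a\<in>A. inner v a * inner w a)"
  by (subst inner_sum_left) (simp add: inner_commute)

text \<open>Here \<open>s\<close> is chosen proportional to \<open>\<Sum>B\<close> in such a way that \<open>\<langle>\<Sum>A, \<Sum>B\<rangle>\<close> cancels. What
remains bounds \<open>|\<Sum>B|\<^sup>2\<close> from below by \<open>500/9\<close>, whereas it is at most \<open>2|B| = 50\<close>.\<close>
lemma not_coupled_29_25:
  assumes AB: "coupled A B" and "card A = 29" "card B = 25"
  shows False
proof -
  define x where "x = inner (\<Sum>A) (\<Sum>B)"
  define w where "w = inner (\<Sum>B) (\<Sum>B)"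
  define Q where "Q = (\<Sum>a\<in>A. (inner (\<Sum>B) a)\<^sup>2)"
  have "inner (3 *\<^sub>R \<Sum>B + (25/3) *\<^sub>R \<Sum>A - (\<Sum>a\<in>A. inner (\<Sum>B) a *\<^sub>R a)) ((3/25) *\<^sub>R \<Sum>B)
      = (3/25) * (3 * w + (25/3) * x - Q)"
    unfolding inner_scaleR_right inner_diff_left inner_add_left inner_scaleR_left inner_frame
    by (simp add: x_def w_def Q_def power2_eq_square)
  then have "0 \<le> 25 * (18 - 2 * 29 / 3) + 2 * x - 2 * ((3/25) * (3 * w + (25/3) * x - Q)) + 25 * ((3/25)\<^sup>2 * w)"
    using defect_inequality[OF AB, of "(3/25) *\<^sub>R \<Sum>B"] assms(2,3)
    by (simp add: x_def[symmetric] w_def[symmetric] power2_eq_square)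
  moreover have "Q \<le> 4 * w"
    unfolding Q_def w_def by (rule simply_laced_frame_bound[OF coupledD(1)[OF AB]])
  moreover have "w \<le> 50"
    using simply_laced_sum_norm[OF coupledD(2)[OF AB]] assms(3) by (simp add: w_def)
  ultimately show False by (simp add: power2_eq_square algebra_simps)
qed

text \<open>With \<open>s = \<Sum>A/3\<close> the constant term and \<open>\<langle>\<Sum>A, \<Sum>B\<rangle>\<close> both cancel; the inequality that is
left reads \<open>9|\<Sum>A|\<^sup>2 \<le> 2\<langle>M(\<Sum>B), \<Sum>A\<rangle>\<close> for the frame operator \<open>M \<le> 4\<close> of \<open>A\<close>. The factor
\<open>8/9 < 1\<close> is what matters: by symmetry both sums vanish.\<close>
lemma coupled_27_27_sum_bound:
  assumes AB: "coupled A B" and "card A = 27" "card B = 27"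
  shows "9 * norm (\<Sum>A) \<le> 8 * norm (\<Sum>B)"
proof -
  define x where "x = inner (\<Sum>A) (\<Sum>B)"
  define w where "w = inner (\<Sum>A) (\<Sum>A)"
  define Q where "Q = (\<Sum>a\<in>A. inner (\<Sum>B) a * inner (\<Sum>A) a)"
  have "inner (3 *\<^sub>R \<Sum>B + 9 *\<^sub>R \<Sum>A - (\<Sum>a\<in>A. inner (\<Sum>B) a *\<^sub>R a)) ((1/3) *\<^sub>R \<Sum>A)
      = (1/3) * (3 * x + 9 * w - Q)"
    unfolding inner_scaleR_right inner_diff_left inner_add_left inner_scaleR_left inner_frame
    by (simp add: x_def w_def Q_def inner_commute)
  then have "0 \<le> 27 * (18 - 2 * 27 / 3) + 2 * x - 2 * ((1/3) * (3 * x + 9 * w - Q)) + 27 * ((1/3)\<^sup>2 * w)"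
    using defect_inequality[OF AB, of "(1/3) *\<^sub>R \<Sum>A"] assms(2,3)
    by (simp add: x_def[symmetric] w_def[symmetric] power2_eq_square)
  then have 1: "9 * w \<le> 2 * Q" by (simp add: power2_eq_square algebra_simps)
  have fr: "(\<Sum>a\<in>A. (inner v a)\<^sup>2) \<le> 4 * inner v v" for v
    by (rule simply_laced_frame_bound[OF coupledD(1)[OF AB]])
  have "\<bar>Q\<bar> \<le> (\<Sum>a\<in>A. \<bar>inner (\<Sum>B) a\<bar> * \<bar>inner (\<Sum>A) a\<bar>)"
    unfolding Q_def by (rule order_trans[OF sum_abs]) (simp add: abs_mult)
  also have "\<dots> \<le> L2_set (inner (\<Sum>B)) A * L2_set (inner (\<Sum>A)) A"
    by (rule L2_set_mult_ineq)
  also have "\<dots> \<le> (2 * norm (\<Sum>B)) * (2 * norm (\<Sum>A))"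
  proof -
    have "L2_set (inner v) A \<le> 2 * norm v" for v
      unfolding L2_set_def using real_sqrt_le_mono[OF fr[of v]]
      by (simp add: real_sqrt_mult norm_eq_sqrt_inner)
    then show ?thesis by (intro mult_mono) (auto simp: L2_set_nonneg)
  qed
  finally have "9 * (norm (\<Sum>A) * norm (\<Sum>A)) \<le> 8 * norm (\<Sum>B) * norm (\<Sum>A)"
    using 1 by (simp add: w_def dot_square_norm power2_eq_square)
  then show ?thesis
    by (cases "norm (\<Sum>A) = 0")
       (simp, metis mult.assoc mult_le_cancel_right norm_ge_zero order_le_less)
qed

lemma coupled_27_27_sum_zero:
  assumes "coupled A B" "card A = 27" "card B = 27"
  shows "\<Sum>A = 0" "\<Sum>B = 0"
proof -
  have "9 * norm (\<Sum>A) \<le> 8 * norm (\<Sum>B)" "9 * norm (\<Sum>B) \<le> 8 * norm (\<Sum>A)"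
    using coupled_27_27_sum_bound[OF assms] coupled_27_27_sum_bound[OF coupled_sym[OF assms(1)] assms(3,2)]
    by auto
  moreover have "0 \<le> norm (\<Sum>A)" "0 \<le> norm (\<Sum>B)" by auto
  ultimately have "norm (\<Sum>A) = 0" "norm (\<Sum>B) = 0" by linarith+
  then show "\<Sum>A = 0" "\<Sum>B = 0" by auto
qed

lemma neighbour_count:
  assumes "simply_laced A" "T \<subseteq> A" "v \<in> A"
  shows "inner (\<Sum>T) v = (if v \<in> T then 2 else 0) - real (card {c\<in>T. inner c v = -1})"
proof -
  note rs = simply_lacedD[OF assms(1)]
  have fT: "finite T" using rs(1) assms(2) finite_subset by blast
  have "inner (\<Sum>T) v = (\<Sum>c\<in>T. (if c = v then 2 else 0) - (if inner c v = -1 then 1 else 0))"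
    unfolding inner_sum_left
  proof (rule sum.cong[OF refl])
    fix c assume "c \<in> T"
    then show "inner c v = (if c = v then 2 else 0) - (if inner c v = -1 then 1 else 0)"
      using rs(2)[OF assms(3)] rs(3)[of c v] assms(2,3) by auto
  qed
  also have "\<dots> = (if v \<in> T then 2 else 0) - (\<Sum>c\<in>T. if inner c v = -1 then 1 else (0::real))"
    using fT by (simp add: sum_subtractf)
  also have "(\<Sum>c\<in>T. if inner c v = -1 then 1 else (0::real)) = real (card {c\<in>T. inner c v = -1})"
    using fT by (simp add: sum.If_cases Int_def)
  finally show ?thesis .
qed

text \<open>Vanishing of \<open>\<Sum>A\<close> and \<open>\<Sum>B\<close> makes the graph of \<open>A\<close> 2-regular and all sets \<open>low A b\<close>,
\<open>low B a\<close> of size \<open>9\<close>, hence \<open>3b = -\<Sum>(low A b)\<close>. Taking inner products with the elements of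
\<open>A\<close> shows that each \<open>low A b\<close> is a perfect code: a vertex outside it has exactly one
neighbour in it, a vertex inside has none. Along a path \<open>a, c, d, a'\<close> it therefore contains
\<open>a'\<close> if it contains \<open>a\<close>; triangle-freeness ensures \<open>a \<noteq> a'\<close>. The nine vectors \<open>b\<close> in
\<open>low B a\<close> are pairwise non-acute but are all correlated with \<open>a + a'\<close>.\<close>
lemma not_coupled_27_27:
  assumes AB: "coupled A B" and tf: "triangle_free A" and cA: "card A = 27" and cB: "card B = 27"
  shows False
proof -
  note rA = simply_lacedD[OF coupledD(1)[OF AB]] and rB = simply_lacedD[OF coupledD(2)[OF AB]]
  have A0: "\<Sum>A = 0" and B0: "\<Sum>B = 0" using coupled_27_27_sum_zero[OF AB cA cB] by auto
  have low9: "card (low A b) = 9" if "b \<in> B" for b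
    using inner_sum_coupled[OF coupled_sym[OF AB] that] A0 cA by simp
  have low9': "card (low B a) = 9" if "a \<in> A" for a
    using inner_sum_coupled[OF AB that] B0 cB by simp
  have code: "3 *\<^sub>R b + \<Sum>(low A b) = 0" if "b \<in> B" for b
    using low_norm[OF AB that] low9[OF that] inner_ge_zero[of "3 *\<^sub>R b + \<Sum>(low A b)"]
    by (simp del: inner_ge_zero)
  define N where "N v = {c\<in>A. inner c v = -1}" for v
  have deg2: "card (N v) = 2" if "v \<in> A" for v
    using neighbour_count[OF coupledD(1)[OF AB] order_refl that] A0 that by (simp add: N_def)
  have other: "\<exists>d\<in>N v. d \<noteq> c" if "v \<in> A" for v c
    using deg2[OF that] by (auto simp: card_2_iff)
  obtain a where a: "a \<in> A" using cA by fastforce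
  obtain c where c: "c \<in> N a" using other[OF a] by blast
  then have cA': "c \<in> A" by (simp add: N_def)
  obtain d where d: "d \<in> N c" "d \<noteq> a" using other[OF cA'] by blast
  then have dA': "d \<in> A" by (simp add: N_def)
  obtain a' where a': "a' \<in> N d" "a' \<noteq> c" using other[OF dA'] by blast
  then have aA': "a' \<in> A" by (simp add: N_def)
  have ne: "a \<noteq> c" "c \<noteq> d" "d \<noteq> a'"
    using c d a' rA(2) by (auto simp: N_def)
  have "a \<noteq> a'"
  proof
    assume "a = a'"
    then have "inner c a = -1" "inner d c = -1" "inner a d = -1" using c d a' by (auto simp: N_def)
    then show False using tf a cA' dA' unfolding triangle_free_def by (metis inner_commute)
  qed
  have finN: "finite (N v)" for v using rA(1) by (simp add: N_def)
  have "a \<in> N c" "c \<in> N d" using c d a cA' by (auto simp: N_def inner_commute)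
  then have Nc: "N c = {a, d}" and Nd: "N d = {c, a'}"
    using card_subset_eq[OF finN, of "{a, d}" c] card_subset_eq[OF finN, of "{c, a'}" d]
      d a' deg2[OF cA'] deg2[OF dA'] by auto
  \<comment> \<open>the perfect code property at \<open>c\<close> and at \<open>d\<close>\<close>
  have transfer: "inner a' b = -2/3" if b: "b \<in> low B a" for b
  proof -
    let ?T = "low A b"
    have bB: "b \<in> B" and aT: "a \<in> ?T" using b a by (auto simp: low_def inner_commute)
    have count: "card (N v \<inter> ?T) = (if v \<in> ?T then 0 else 1)" if v: "v \<in> A" for v
    proof -
      have "0 = 3 * inner v b + inner (\<Sum>?T) v"
        using arg_cong[OF code[OF bB], of "\<lambda>z. inner z v"]
        by (simp add: inner_add_left inner_commute[of b v])
      moreover have "?T \<subseteq> A" by (auto simp: low_def)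
      moreover have "{c\<in>?T. inner c v = -1} = N v \<inter> ?T" by (auto simp: N_def low_def)
      ultimately have "0 = 3 * inner v b + (if v \<in> ?T then 2 else 0) - real (card (N v \<inter> ?T))"
        using neighbour_count[OF coupledD(1)[OF AB] _ v, of ?T] by simp
      then show ?thesis using coupledD(3)[OF AB v bB] by (cases "v \<in> ?T") simp_all
    qed
    have "c \<notin> ?T" "card ({a, d} \<inter> ?T) = 1"
      using count[OF cA'] aT by (auto simp: Nc split: if_splits)
    then have "d \<notin> ?T" using aT d(2) by auto
    then have "card ({c, a'} \<inter> ?T) = 1" using count[OF dA'] by (simp add: Nd)
    then have "a' \<in> ?T" using \<open>c \<notin> ?T\<close> by (cases "a' \<in> ?T") auto
    then show ?thesis by (simp add: low_def)
  qed
  define S where "S = \<Sum>(low B a)"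
  have "simply_laced (low B a)"
    using coupledD(2)[OF AB] by (rule simply_laced_subset) (auto simp: low_def)
  then have S1: "inner S S \<le> 18"
    using simply_laced_sum_norm low9'[OF a] unfolding S_def by fastforce
  have "inner S (a + a') = (\<Sum>b\<in>low B a. -4/3)"
    unfolding S_def inner_sum_left
  proof (rule sum.cong[OF refl])
    fix b assume "b \<in> low B a"
    then show "inner b (a + a') = -4/3"
      using transfer[of b] by (simp add: low_def inner_add_right inner_commute)
  qed
  then have S2: "inner S (a + a') = -12" using low9'[OF a] by simp
  have S3: "inner (a + a') (a + a') \<le> 4"
    using rA(2)[OF a] rA(2)[OF aA'] rA(3)[OF a aA' \<open>a \<noteq> a'\<close>]
    by (auto simp: inner_add_left inner_add_right inner_commute)
  have "(inner S (a + a'))\<^sup>2 \<le> inner S S * inner (a + a') (a + a')"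
    by (rule Cauchy_Schwarz_ineq)
  also have "\<dots> \<le> 18 * 4" using S1 S3 by (intro mult_mono) auto
  finally show False by (simp add: S2)
qed

text \<open>Larger sets contain subsets of exactly the excluded sizes, and all hypotheses pass to
subsets.\<close>
lemma coupled_card_bounds:
  fixes A B :: "'a::real_inner set"
  assumes AB: "coupled A B" and tf: "triangle_free A"
  shows "\<not> (27 \<le> card A \<and> 27 \<le> card B)" "\<not> (29 \<le> card A \<and> 25 \<le> card B)"
proof -
  have red: False if kl: "k \<le> card A" "l \<le> card B"
    and no: "\<And>A' B' :: 'a set. coupled A' B' \<Longrightarrow> triangle_free A' \<Longrightarrow> card A' = k \<Longrightarrow> card B' = l \<Longrightarrow> False" for k l
  proof -
    obtain A' where A': "A' \<subseteq> A" "card A' = k" using obtain_subset_with_card_n[OF kl(1)] by blast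
    obtain B' where B': "B' \<subseteq> B" "card B' = l" using obtain_subset_with_card_n[OF kl(2)] by blast
    show False
      using no[OF coupled_subset[OF AB A'(1) B'(1)] triangle_free_subset[OF tf A'(1)] A'(2) B'(2)] .
  qed
  show "\<not> (27 \<le> card A \<and> 27 \<le> card B)"
  proof
    assume "27 \<le> card A \<and> 27 \<le> card B"
    then show False by (elim conjE) (rule red, auto intro: not_coupled_27_27)
  qed
  show "\<not> (29 \<le> card A \<and> 25 \<le> card B)"
  proof
    assume "29 \<le> card A \<and> 25 \<le> card B"
    then show False by (elim conjE) (rule red, auto intro: not_coupled_29_25)
  qed
qed

section \<open>Pillars over a base of five vectors\<close>

lemma sum_sign:
  fixes n :: nat
  assumes "E \<subseteq> {..<n}"
  shows "(\<Sum>i<n. if i \<in> E then 1/5 else -1/5 :: real) = (2 * real (card E) - real n) / 5"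
proof -
  have "(\<Sum>i<n. if i \<in> E then 1/5 else -1/5 :: real) = (\<Sum>i<n. (if i \<in> E then 2/5 else 0) - 1/5)"
    by (rule sum.cong) auto
  also have "\<dots> = (2/5) * real (card ({..<n} \<inter> E)) - real n / 5"
    by (simp add: sum_subtractf sum.If_cases)
  finally show ?thesis using assms by (simp add: Int_absorb1 diff_divide_distrib)
qed

lemma sum_sign_mult:
  fixes n :: nat
  assumes "E \<subseteq> {..<n}" "F \<subseteq> {..<n}"
  shows "(\<Sum>i<n. (if i \<in> E then 1/5 else -1/5) * (if i \<in> F then 1/5 else -1/5 :: real))
    = (real n - 2 * real (card E) - 2 * real (card F) + 4 * real (card (E \<inter> F))) / 25"
proof -
  have "(\<Sum>i<n. (if i \<in> E then 1/5 else -1/5) * (if i \<in> F then 1/5 else -1/5 :: real))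
    = (\<Sum>i<n. 1/25 - (if i \<in> E then 2/25 else 0) - (if i \<in> F then 2/25 else 0)
        + (if i \<in> E \<inter> F then 4/25 else 0))"
    by (rule sum.cong) auto
  also have "\<dots> = real n / 25 - (2/25) * real (card ({..<n} \<inter> E)) - (2/25) * real (card ({..<n} \<inter> F))
      + (4/25) * real (card ({..<n} \<inter> (E \<inter> F)))"
    unfolding sum_subtractf sum.distrib sum.If_cases[OF finite_lessThan] Collect_mem_eq by simp
  finally show ?thesis using assms by (simp add: Int_absorb1 le_infI1 field_simps)
qed

text \<open>If every value is at most \<open>26\<close>, the sum is at most \<open>260\<close>. Otherwise exactly one value
exceeds \<open>26\<close>, and the bound is \<open>28 + 9 \<cdot> 26 = 262\<close> or \<open>45 + 9 \<cdot> 24 = 261\<close>.\<close>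
lemma sum_le_262:
  fixes f :: "'i \<Rightarrow> nat"
  assumes fin: "finite I" and c: "2 \<le> card I" "card I \<le> 10"
    and f45: "\<And>i. i \<in> I \<Longrightarrow> f i \<le> 45"
    and f27: "\<And>i j. i \<in> I \<Longrightarrow> j \<in> I \<Longrightarrow> i \<noteq> j \<Longrightarrow> \<not> (27 \<le> f i \<and> 27 \<le> f j)"
    and f29: "\<And>i j. i \<in> I \<Longrightarrow> j \<in> I \<Longrightarrow> i \<noteq> j \<Longrightarrow> \<not> (29 \<le> f i \<and> 25 \<le> f j)"
  shows "sum f I \<le> 262"
proof (cases "\<exists>i\<in>I. 27 \<le> f i")
  case False
  then have "sum f I \<le> card I * 26" using sum_bounded_above[of I f 26] by force
  then show ?thesis using c by linarith
next
  case True
  then obtain i where i: "i \<in> I" "27 \<le> f i" by auto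
  have S: "sum f I = f i + sum f (I - {i})" using fin i by (simp add: sum.remove)
  have cI: "card (I - {i}) \<le> 9" using fin i c by simp
  have bound: "sum f (I - {i}) \<le> 9 * k" if "\<And>j. j \<in> I - {i} \<Longrightarrow> f j \<le> k" for k
  proof -
    have "sum f (I - {i}) \<le> card (I - {i}) * k" using sum_bounded_above[of "I - {i}" f k] that by simp
    then show ?thesis using cI by (meson le_trans mult_le_mono1)
  qed
  show ?thesis
  proof (cases "29 \<le> f i")
    case True
    have "f j \<le> 24" if "j \<in> I - {i}" for j using f29[of i j] that i True by force
    then show ?thesis using S bound[of 24] f45[OF i(1)] by fastforce
  next
    case False
    have "f j \<le> 26" if "j \<in> I - {i}" for j using f27[of i j] that i by force
    then show ?thesis using S bound[of 26] False by fastforce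
  qed
qed

text \<open>A base of five vectors and a set \<open>N\<close> of further unit vectors, with all the angles that
an equiangular set provides. The sets \<open>fiber E\<close> below are the pillars, indexed by the set
\<open>E\<close> of the positive signs.\<close>
locale five_base =
  fixes p :: "nat \<Rightarrow> 'a::real_inner" and N :: "'a set"
  assumes base: "\<And>i j. i < 5 \<Longrightarrow> j < 5 \<Longrightarrow> inner (p i) (p j) = (if i = j then 1 else -1/5)"
    and fin: "finite N"
    and unit: "\<And>x. x \<in> N \<Longrightarrow> inner x x = 1"
    and angle: "\<And>x y. x \<in> N \<Longrightarrow> y \<in> N \<Longrightarrow> x \<noteq> y \<Longrightarrow> inner x y = 1/5 \<or> inner x y = -1/5"
    and base_angle: "\<And>x i. x \<in> N \<Longrightarrow> i < 5 \<Longrightarrow> inner x (p i) = 1/5 \<or> inner x (p i) = -1/5"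
begin

definition pos :: "'a \<Rightarrow> nat set" where
  "pos x = {i. i < 5 \<and> inner x (p i) > 0}"

definition fiber :: "nat set \<Rightarrow> 'a set" where
  "fiber E = {x\<in>N. pos x = E}"

text \<open>The orthogonal projection along the span of the base; the coefficients come from the
inverse \<open>5/6 (I + J)\<close> of the Gram matrix \<open>6/5 I - 1/5 J\<close> of the base.\<close>
definition q :: "'a \<Rightarrow> 'a" where
  "q x = x - (5/6) *\<^sub>R (\<Sum>i<5. (inner x (p i) + (\<Sum>j<5. inner x (p j))) *\<^sub>R p i)"

lemma pos_subset: "pos x \<subseteq> {..<5}"
  by (auto simp: pos_def)

lemma finite_pos: "finite (pos x)"
  using pos_subset finite_subset by blast

lemma inner_base: "x \<in> N \<Longrightarrow> i < 5 \<Longrightarrow> inner x (p i) = (if i \<in> pos x then 1/5 else -1/5)"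
  using base_angle[of x i] by (auto simp: pos_def)

lemma q_orthogonal:
  assumes k: "k < 5"
  shows "inner (q x) (p k) = 0"
proof -
  define s where "s = (\<Sum>j<5. inner x (p j))"
  have "(\<Sum>i<5. (inner x (p i) + s) * inner (p i) (p k))
      = (\<Sum>i<5. (if i = k then (6/5) * (inner x (p i) + s) else 0) - (1/5) * (inner x (p i) + s))"
    by (rule sum.cong) (use base k in \<open>auto simp: algebra_simps\<close>)
  also have "\<dots> = (6/5) * (inner x (p k) + s) - (1/5) * (\<Sum>i<5. inner x (p i) + s)"
    unfolding sum_subtractf sum_distrib_left using k by simp
  also have "(\<Sum>i<5. inner x (p i) + s) = 6 * s" by (simp add: sum.distrib s_def)
  finally have "(\<Sum>i<5. (inner x (p i) + s) * inner (p i) (p k)) = (6/5) * inner x (p k)"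
    by (simp add: field_simps)
  then show ?thesis
    by (simp add: q_def inner_diff_left inner_sum_left s_def)
qed

lemma inner_q:
  "inner (q x) (q y) = inner x y
    - (5/6) * ((\<Sum>i<5. inner x (p i) * inner y (p i)) + (\<Sum>i<5. inner x (p i)) * (\<Sum>i<5. inner y (p i)))"
proof -
  have "inner (q x) (q y) = inner (q x) y"
  proof -
    have "inner (q x) (\<Sum>i<5. f i *\<^sub>R p i) = 0" for f :: "nat \<Rightarrow> real"
      by (simp add: inner_sum_right q_orthogonal)
    then show ?thesis by (simp only: q_def[of y] inner_diff_right inner_scaleR_right)
  qed
  also have "\<dots> = inner x y - (5/6) * (\<Sum>i<5. (inner x (p i) + (\<Sum>j<5. inner x (p j))) * inner y (p i))"
    
    unfolding q_def inner_diff_left inner_scaleR_left inner_sum_left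
    by (simp add: inner_commute[of _ y])
  also have "(\<Sum>i<5. (inner x (p i) + (\<Sum>j<5. inner x (p j))) * inner y (p i))
    = (\<Sum>i<5. inner x (p i) * inner y (p i)) + (\<Sum>i<5. inner x (p i)) * (\<Sum>i<5. inner y (p i))"
    by (simp add: distrib_right sum.distrib sum_distrib_left)
  finally show ?thesis .
qed

lemma inner_q_pos:
  assumes "x \<in> N" "y \<in> N"
  shows "inner (q x) (q y) = inner x y
    - (5 - 2 * real (card (pos x)) - 2 * real (card (pos y)) + 4 * real (card (pos x \<inter> pos y))
        + (2 * real (card (pos x)) - 5) * (2 * real (card (pos y)) - 5)) / 30"
proof -
  have s: "(\<Sum>i<5. inner z (p i)) = (2 * real (card (pos z)) - 5) / 5" if "z \<in> N" for z
    using sum_sign[OF pos_subset, of z] inner_base[OF that] by simp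
  have m: "(\<Sum>i<5. inner x (p i) * inner y (p i))
     = (5 - 2 * real (card (pos x)) - 2 * real (card (pos y)) + 4 * real (card (pos x \<inter> pos y))) / 25"
    using sum_sign_mult[OF pos_subset pos_subset, of x y] inner_base assms by simp
  show ?thesis unfolding inner_q s[OF assms(1)] s[OF assms(2)] m by (simp add: field_simps)
qed

text \<open>Six vectors of squared norm \<open>8/15\<close> with pairwise inner products at most \<open>-2/15\<close> would
have a sum of negative squared norm.\<close>
lemma card_singleton_fibers_le:
  "card {x\<in>N. card (pos x) = 1} \<le> 5"
proof -
  let ?S = "{x\<in>N. card (pos x) = 1}"
  have finS: "finite ?S" using fin by simp
  have ip: "inner (q x) (q y) \<le> (if x = y then 2/3 else 0) - 2/15" if "x \<in> ?S" "y \<in> ?S" for x y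
  proof (cases "x = y")
    case True
    then show ?thesis using that inner_q_pos[of x x] unit[of x] by simp
  next
    case False
    have "inner (q x) (q y) = inner x y - (10 + 4 * real (card (pos x \<inter> pos y))) / 30"
      using that inner_q_pos[of x y] by simp
    moreover have "inner x y \<le> 1/5" using that angle[of x y] False by auto
    moreover have "0 \<le> real (card (pos x \<inter> pos y))" by simp
    ultimately show ?thesis using False by (simp add: field_simps)
  qed
  have "0 \<le> inner (\<Sum>x\<in>?S. q x) (\<Sum>x\<in>?S. q x)" by simp
  also have "\<dots> = (\<Sum>x\<in>?S. \<Sum>y\<in>?S. inner (q x) (q y))"
    by (subst inner_sum_left, subst inner_sum_right) simp
  also have "\<dots> \<le> (\<Sum>x\<in>?S. \<Sum>y\<in>?S. (if x = y then 2/3 else 0) - 2/15)"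
    by (intro sum_mono ip)
  also have "\<dots> = real (card ?S) * (2/3 - real (card ?S) * (2/15))"
    using finS by (simp add: sum_subtractf)
  finally have "card ?S = 0 \<or> real (card ?S) * (2/15) \<le> 2/3"
    by (auto simp: zero_le_mult_iff)
  then show ?thesis by auto
qed

text \<open>A single pillar of two positive signs has projections of squared norm \<open>4/5\<close>; the
factor turns this into \<open>2\<close>.\<close>
definition scaled :: "'a \<Rightarrow> 'a" where
  "scaled x = sqrt (5/2) *\<^sub>R q x"

lemma inner_scaled: "inner (scaled x) (scaled y) = (5/2) * inner (q x) (q y)"
proof -
  have sq: "sqrt (5/2) * sqrt (5/2) = (5/2 :: real)" by simp
  show ?thesis unfolding scaled_def inner_scaleR_left inner_scaleR_right mult.assoc[symmetric] sq ..
qed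

lemma inner_scaled_fiber:
  assumes "x \<in> fiber E" "y \<in> fiber F" "card E = 2" "card F = 2"
  shows "inner (scaled x) (scaled y) = (5/2) * inner x y - (2 * real (card (E \<inter> F)) - 1) / 6"
  using assms inner_q_pos[of x y] by (simp add: inner_scaled fiber_def algebra_simps)

lemma inner_scaled_same:
  assumes "x \<in> fiber E" "y \<in> fiber E" "card E = 2"
  shows "inner (scaled x) (scaled y) = (5/2) * inner x y - 1/2"
  using inner_scaled_fiber[OF assms(1,2,3,3)] assms(3) by simp

lemma scaled_inj:
  assumes "card E = 2"
  shows "inj_on scaled (fiber E)"
proof (rule inj_onI, rule ccontr)
  fix x y assume xy: "x \<in> fiber E" "y \<in> fiber E" "scaled x = scaled y" "x \<noteq> y"
  have "inner (scaled x) (scaled y) = 2"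
    using inner_scaled_same[OF xy(1,1) assms] xy unit[of x] by (simp add: fiber_def)
  then show False
    using inner_scaled_same[OF xy(1,2) assms] angle[of x y] xy by (auto simp: fiber_def)
qed

lemma simply_laced_fiber:
  assumes "card E = 2"
  shows "simply_laced (scaled ` fiber E)"
  unfolding simply_laced_def
proof (intro conjI ballI impI)
  show "finite (scaled ` fiber E)" using fin by (simp add: fiber_def)
next
  fix a assume "a \<in> scaled ` fiber E"
  then obtain x where "x \<in> fiber E" "a = scaled x" by auto
  then show "inner a a = 2" using inner_scaled_same[of x E x] assms unit[of x] by (simp add: fiber_def)
next
  fix a b assume "a \<in> scaled ` fiber E" "b \<in> scaled ` fiber E" "a \<noteq> b"
  then obtain x y where "x \<in> fiber E" "a = scaled x" "y \<in> fiber E" "b = scaled y" "x \<noteq> y" by auto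
  then show "inner a b \<in> {0, -1}"
    using inner_scaled_same[of x E y] assms angle[of x y] by (auto simp: fiber_def)
qed

text \<open>Sign patterns that share one positive position lead to the inner products \<open>1/3, -2/3\<close>,
disjoint patterns to their negatives. In the latter case one of the two pillars has to be
negated.\<close>
lemma coupled_fibers:
  assumes E: "card E = 2" and F: "card F = 2" and EF: "E \<noteq> F" and fE: "finite E" "finite F"
  shows "coupled (scaled ` fiber E) (scaled ` fiber F) \<or> coupled (scaled ` fiber E) (uminus ` scaled ` fiber F)"
proof -
  have neg: "simply_laced (uminus ` scaled ` fiber F)"
    using simply_laced_fiber[OF F] unfolding simply_laced_def by auto
  have ne: "x \<noteq> y" if "x \<in> fiber E" "y \<in> fiber F" for x y using that EF by (auto simp: fiber_def)
  have ang: "inner x y = 1/5 \<or> inner x y = -1/5" if "x \<in> fiber E" "y \<in> fiber F" for x y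
    using angle[of x y] ne[OF that] that by (auto simp: fiber_def)
  have "card (E \<inter> F) \<noteq> 2"
    using E F EF fE by (metis card_subset_eq inf_le1 inf_le2)
  moreover have "card (E \<inter> F) \<le> 2" using card_mono[of E "E \<inter> F"] fE E by simp
  ultimately consider "card (E \<inter> F) = 1" | "card (E \<inter> F) = 0" by linarith
  then show ?thesis
  proof cases
    case 1
    have "inner (scaled x) (scaled y) \<in> {1/3, -2/3}" if "x \<in> fiber E" "y \<in> fiber F" for x y
      using inner_scaled_fiber[OF that E F] ang[OF that] 1 by auto
    then have "coupled (scaled ` fiber E) (scaled ` fiber F)"
      using simply_laced_fiber E F unfolding coupled_def by blast
    then show ?thesis ..
  next
    case 2
    have "inner (scaled x) (- scaled y) \<in> {1/3, -2/3}" if "x \<in> fiber E" "y \<in> fiber F" for x y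
      using inner_scaled_fiber[OF that E F] ang[OF that] 2 by auto
    then have "coupled (scaled ` fiber E) (uminus ` scaled ` fiber F)"
      using simply_laced_fiber[OF E] neg unfolding coupled_def by blast
    then show ?thesis ..
  qed
qed

end

text \<open>Normalization permits at most two positive signs. Maximality of the base excludes sign
vectors that are entirely negative and triangles inside a pillar.\<close>
locale five_base_maximal = five_base +
  assumes pos_card: "\<And>x. x \<in> N \<Longrightarrow> card (pos x) = 1 \<or> card (pos x) = 2"
    and no_triangle: "\<And>x y z. x \<in> N \<Longrightarrow> y \<in> N \<Longrightarrow> z \<in> N \<Longrightarrow> card (pos x) = 2 \<Longrightarrow> pos y = pos x \<Longrightarrow> pos z = pos x
      \<Longrightarrow> \<not> (inner x y = -1/5 \<and> inner y z = -1/5 \<and> inner x z = -1/5)"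
begin

lemma triangle_free_fiber:
  assumes E: "card E = 2"
  shows "triangle_free (scaled ` fiber E)"
  unfolding triangle_free_def
proof (intro ballI notI)
  fix a b c assume "a \<in> scaled ` fiber E" "b \<in> scaled ` fiber E" "c \<in> scaled ` fiber E"
    and ip: "inner a b = - 1 \<and> inner b c = - 1 \<and> inner a c = - 1"
  then obtain x y z where xyz: "x \<in> fiber E" "y \<in> fiber E" "z \<in> fiber E" "a = scaled x" "b = scaled y" "c = scaled z"
    by blast
  have "inner x y = -1/5" "inner y z = -1/5" "inner x z = -1/5"
    using ip inner_scaled_same[OF xyz(1,2) E] inner_scaled_same[OF xyz(2,3) E] inner_scaled_same[OF xyz(1,3) E]
    by (simp_all add: xyz(4-6))
  then show False
    using no_triangle[of x y z] xyz(1-3) E by (simp add: fiber_def)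
qed

lemma fiber_card_bounds:
  assumes E: "card E = 2" and F: "card F = 2" and EF: "E \<noteq> F" and fE: "finite E" "finite F"
  shows "\<not> (27 \<le> card (fiber E) \<and> 27 \<le> card (fiber F))" "\<not> (29 \<le> card (fiber E) \<and> 25 \<le> card (fiber F))"
    "fiber F \<noteq> {} \<Longrightarrow> card (fiber E) \<le> 45"
proof -
  obtain B where B: "coupled (scaled ` fiber E) B" "card B = card (fiber F)"
  proof (cases "coupled (scaled ` fiber E) (scaled ` fiber F)")
    case True
    then show thesis using that card_image[OF scaled_inj[OF F]] by blast
  next
    case False
    have "card (uminus ` scaled ` fiber F) = card (fiber F)"
      using card_image[OF scaled_inj[OF F]] by (simp add: card_image)
    then show thesis using that coupled_fibers[OF assms] False by blast
  qed
  note cA = card_image[OF scaled_inj[OF E]]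
  show "\<not> (27 \<le> card (fiber E) \<and> 27 \<le> card (fiber F))" "\<not> (29 \<le> card (fiber E) \<and> 25 \<le> card (fiber F))"
    using coupled_card_bounds[OF B(1) triangle_free_fiber[OF E]] by (simp_all add: cA B(2))
  assume "fiber F \<noteq> {}"
  then have "card B \<noteq> 0" using B(2) fin by (simp add: fiber_def)
  then obtain b where "b \<in> B" by fastforce
  then show "card (fiber E) \<le> 45" using card_coupled_le_45[OF B(1)] cA by metis
qed

definition patterns :: "nat set set" where
  "patterns = pos ` {x\<in>N. card (pos x) = 2}"

lemma patternD:
  assumes "E \<in> patterns"
  shows "card E = 2" "finite E" "fiber E \<noteq> {}"
  using assms finite_pos by (auto simp: patterns_def fiber_def)

lemma card_eq_patterns:
  "card N = card {x\<in>N. card (pos x) = 1} + (\<Sum>E\<in>patterns. card (fiber E))"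
proof -
  have "{x\<in>N. card (pos x) = 2} = (\<Union>E\<in>patterns. fiber E)"
    by (auto simp: patterns_def fiber_def)
  also have "card \<dots> = (\<Sum>E\<in>patterns. card (fiber E))"
    by (rule card_UN_disjoint) (auto simp: fiber_def patterns_def fin)
  finally have "card {x\<in>N. card (pos x) = 2} = (\<Sum>E\<in>patterns. card (fiber E))" .
  moreover have "card ({x\<in>N. card (pos x) = 1} \<union> {x\<in>N. card (pos x) = 2})
      = card {x\<in>N. card (pos x) = 1} + card {x\<in>N. card (pos x) = 2}"
    by (rule card_Un_disjoint) (auto simp: fin)
  moreover have "{x\<in>N. card (pos x) = 1} \<union> {x\<in>N. card (pos x) = 2} = N"
    using pos_card by auto
  ultimately show ?thesis by simp
qed

lemma card_le_267:
  assumes "2 \<le> card patterns"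
  shows "card N \<le> 267"
proof -
  have finp: "finite patterns" using fin by (simp add: patterns_def)
  have "patterns \<subseteq> {E. E \<subseteq> {..<5} \<and> card E = 2}"
    using pos_subset by (auto simp: patterns_def)
  then have "card patterns \<le> 5 choose 2"
    using card_mono[of "{E. E \<subseteq> {..<5::nat} \<and> card E = 2}" patterns] n_subsets[of "{..<5::nat}" 2] by simp
  then have c10: "card patterns \<le> 10" by (simp add: choose_two)
  have "(\<Sum>E\<in>patterns. card (fiber E)) \<le> 262"
  proof (rule sum_le_262[OF finp assms c10])
    fix E assume E: "E \<in> patterns"
    have "card (patterns - {E}) \<noteq> 0" using assms E finp by simp
    then obtain F where "F \<in> patterns - {E}" by (metis card.empty equals0I)
    then show "card (fiber E) \<le> 45" using fiber_card_bounds(3)[of E F] patternD E by blast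
  next
    fix E F assume EF: "E \<in> patterns" "F \<in> patterns" "E \<noteq> F"
    note b = fiber_card_bounds[OF patternD(1)[OF EF(1)] patternD(1)[OF EF(2)] EF(3)
        patternD(2)[OF EF(1)] patternD(2)[OF EF(2)]]
    show "\<not> (27 \<le> card (fiber E) \<and> 27 \<le> card (fiber F))" by (rule b(1))
    show "\<not> (29 \<le> card (fiber E) \<and> 25 \<le> card (fiber F))" by (rule b(2))
  qed
  then show ?thesis using card_eq_patterns card_singleton_fibers_le by simp
qed

text \<open>The Euclidean dimension enters only as the bound \<open>d\<close>, so that \<open>N\<close> may live in any real
inner product space.\<close>
lemma fiber_card_le_dim:
  fixes d :: nat
  assumes dim: "\<And>S :: 'a set. simply_laced S \<Longrightarrow> triangle_free S \<Longrightarrow> 3 * card S \<le> d"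
    and "card patterns \<le> 1"
  shows "3 * card N \<le> d + 15"
proof -
  have finp: "finite patterns" using fin by (simp add: patterns_def)
  have "3 * (\<Sum>E\<in>patterns. card (fiber E)) \<le> d"
  proof (cases "patterns = {}")
    case False
    then have "card patterns = 1" using assms(2) finp by (simp add: Suc_leI card_gt_0_iff le_antisym)
    then obtain E where E: "patterns = {E}" by (rule card_1_singletonE)
    then have "card E = 2" using patternD by blast
    then have "3 * card (scaled ` fiber E) \<le> d"
      by (intro dim simply_laced_fiber triangle_free_fiber)
    then show ?thesis using card_image[OF scaled_inj[OF \<open>card E = 2\<close>]] E by simp
  qed simp
  then show ?thesis using card_eq_patterns card_singleton_fibers_le by simp
qed

end

section \<open>Gram matrices, base size and switching\<close>

lemma signed_permutation_conjugate:
  assumes A: "A \<in> carrier_mat k k" and p: "\<pi> permutes {..<k}" and ij: "i < k" "j < k"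
  shows "(transpose_mat (perm_matrix k \<pi> * mat_diag k b) * A * (perm_matrix k \<pi> * mat_diag k b)) $$ (i, j)
    = b i * b j * A $$ (\<pi> i, \<pi> j)"
proof -
  define M where "M = Matrix.mat k k (\<lambda>(i, j). if i = \<pi> j then b j else 0)"
  have M: "perm_matrix k \<pi> * mat_diag k b = M"
    unfolding M_def perm_matrix_def
    by (subst mat_diag_mult_right[of _ k k]) (auto intro!: eq_matI)
  have Mc: "M \<in> carrier_mat k k" by (simp add: M_def)
  have pk: "\<pi> l < k" if "l < k" for l using permutes_in_image[OF p, of l] that by simp
  have 1: "(transpose_mat M * A) $$ (i, l) = b i * A $$ (\<pi> i, l)" if "l < k" for l
  proof -
    have "(transpose_mat M * A) $$ (i, l) = (\<Sum>m<k. M $$ (m, i) * A $$ (m, l))"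
      using A Mc ij that by (simp add: scalar_prod_def lessThan_atLeast0)
    also have "\<dots> = (\<Sum>m<k. if m = \<pi> i then b i * A $$ (m, l) else 0)"
      by (rule sum.cong) (use ij in \<open>auto simp: M_def\<close>)
    finally show ?thesis using pk[OF ij(1)] by simp
  qed
  define D where "D = transpose_mat M * A"
  have Dc: "D \<in> carrier_mat k k" using A Mc by (simp add: D_def)
  have "(D * M) $$ (i, j) = (\<Sum>l<k. D $$ (i, l) * M $$ (l, j))"
    using Dc Mc ij by (simp add: scalar_prod_def lessThan_atLeast0)
  also have "\<dots> = (\<Sum>l<k. if l = \<pi> j then b i * b j * A $$ (\<pi> i, l) else 0)"
    by (rule sum.cong) (use ij 1 in \<open>auto simp: M_def D_def simp del: index_mult_mat\<close>)
  finally show ?thesis unfolding M using pk[OF ij(2)] by (simp add: D_def)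
qed

lemma gram_carrier: "gram xs \<in> carrier_mat (length xs) (length xs)"
  by (simp add: gram_def)

lemma gram_index: "i < length xs \<Longrightarrow> j < length xs \<Longrightarrow> gram xs $$ (i, j) = inner (xs ! i) (xs ! j)"
  by (simp add: gram_def)

lemma base_gram_index:
  "i < k \<Longrightarrow> j < k \<Longrightarrow> base_gram \<alpha> k $$ (i, j) = (if i = j then 1 else -\<alpha>)"
  by (simp add: base_gram_def)

lemma base_gram_dim: "dim_row (base_gram \<alpha> k) = k" "dim_col (base_gram \<alpha> k) = k"
  by (simp_all add: base_gram_def)

text \<open>Needed for the finiteness of the set of sizes whose maximum defines \<open>base_size\<close>: a
repeated vector would produce an entry \<open>\<plusminus>1\<close> off the diagonal.\<close>
lemma gram_equivalent_base_distinct: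
  assumes X: "equiangular \<alpha> X" and ps: "length ps = k" "set ps \<subseteq> X"
    and G: "gram_equivalent k (gram ps) (base_gram \<alpha> k)"
  shows "distinct ps"
  unfolding distinct_conv_nth
proof (intro allI impI notI)
  fix i j assume ij: "i < length ps" "j < length ps" "i \<noteq> j" "ps ! i = ps ! j"
  obtain b \<pi> where b: "\<forall>i<k. b i \<in> {-1, 1}" and p: "\<pi> permutes {..<k}"
    and eq: "base_gram \<alpha> k = transpose_mat (perm_matrix k \<pi> * mat_diag k b) * gram ps * (perm_matrix k \<pi> * mat_diag k b)"
    using G unfolding gram_equivalent_def Let_def by blast
  have "i \<in> \<pi> ` {..<k}" "j \<in> \<pi> ` {..<k}" using ij ps(1) by (simp_all add: permutes_image[OF p])
  then obtain i' j' where i'j': "\<pi> i' = i" "\<pi> j' = j" "i' < k" "j' < k" by auto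
  have "base_gram \<alpha> k $$ (i', j') = b i' * b j' * gram ps $$ (\<pi> i', \<pi> j')"
    unfolding eq using gram_carrier[of ps] ps(1) p i'j'(3,4) by (intro signed_permutation_conjugate) auto
  moreover have "inner (ps ! i) (ps ! i) = 1"
    using X ps ij nth_mem[OF ij(1)] unfolding equiangular_def by (metis dot_square_norm power_one subsetD)
  moreover have "i' \<noteq> j'" using i'j' ij by auto
  ultimately have "- \<alpha> = b i' * b j'"
    using ij i'j' by (simp add: base_gram_index gram_index)
  moreover have "b i' = -1 \<or> b i' = 1" "b j' = -1 \<or> b j' = 1" using b i'j' by auto
  moreover have "0 \<le> \<alpha>" "\<alpha> < 1" using X by (auto simp: equiangular_def)
  ultimately show False by auto
qed

text \<open>A set-based criterion that hides lists, signs and permutations: signs are moved from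
the vectors into the diagonal matrix, with the identity as permutation.\<close>
lemma card_le_base_size:
  assumes X: "equiangular \<alpha> X" and S: "finite S" "\<And>x. x \<in> S \<Longrightarrow> x \<in> X \<or> - x \<in> X"
    and ip: "\<And>x y. x \<in> S \<Longrightarrow> y \<in> S \<Longrightarrow> x \<noteq> y \<Longrightarrow> inner x y = -\<alpha>"
  shows "card S \<le> base_size \<alpha> X"
proof -
  let ?K = "{k. \<exists>ps. length ps = k \<and> set ps \<subseteq> X \<and> gram_equivalent k (gram ps) (base_gram \<alpha> k)}"
  have finX: "finite X" using X by (simp add: equiangular_def)
  have "k \<le> card X" if "k \<in> ?K" for k
  proof -
    from that obtain ps where ps: "length ps = k" "set ps \<subseteq> X" "gram_equivalent k (gram ps) (base_gram \<alpha> k)"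
      by blast
    have "k = card (set ps)"
      using distinct_card[OF gram_equivalent_base_distinct[OF X ps]] ps(1) by simp
    then show ?thesis using card_mono[OF finX ps(2)] by simp
  qed
  then have finK: "finite ?K" by (meson finite_nat_set_iff_bounded_le)
  obtain xs where xs: "set xs = S" "distinct xs" using finite_distinct_list[OF S(1)] by blast
  define k where "k = length xs"
  have kS: "k = card S" using xs distinct_card k_def by metis
  define s where "s x = (if x \<in> X then 1 else -1 :: real)" for x
  define ys where "ys = map (\<lambda>x. s x *\<^sub>R x) xs"
  have ysX: "set ys \<subseteq> X" using S(2) xs(1) by (fastforce simp: ys_def s_def)
  have leny: "length ys = k" by (simp add: ys_def k_def)
  have ss: "s x * s x = 1" for x by (simp add: s_def)
  have unit: "inner x x = 1" if "x \<in> S" for x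
  proof -
    have "norm x = 1" using S(2)[OF that] X unfolding equiangular_def by (metis norm_minus_cancel)
    then show ?thesis by (simp add: dot_square_norm)
  qed
  have "base_gram \<alpha> k = transpose_mat (perm_matrix k id * mat_diag k (\<lambda>i. s (xs ! i))) * gram ys
      * (perm_matrix k id * mat_diag k (\<lambda>i. s (xs ! i)))" (is "_ = ?R")
  proof (rule eq_matI)
    fix i j assume "i < dim_row ?R" "j < dim_col ?R"
    then have ij: "i < k" "j < k" by (simp_all add: perm_matrix_def mat_diag_def)
    have "?R $$ (i, j) = s (xs ! i) * s (xs ! j) * gram ys $$ (id i, id j)"
      by (rule signed_permutation_conjugate) (use gram_carrier[of ys] leny ij in \<open>auto simp: permutes_id\<close>)
    also have "\<dots> = (s (xs ! i) * s (xs ! i)) * (s (xs ! j) * s (xs ! j)) * inner (xs ! i) (xs ! j)"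
      using ij leny by (simp add: gram_index ys_def k_def mult_ac)
    also have "\<dots> = inner (xs ! i) (xs ! j)" by (simp add: ss)
    also have "\<dots> = (if i = j then 1 else -\<alpha>)"
      using ij xs unit[of "xs ! i"] ip[of "xs ! i" "xs ! j"] nth_eq_iff_index_eq[OF xs(2)]
      by (auto simp: k_def)
    finally show "base_gram \<alpha> k $$ (i, j) = ?R $$ (i, j)" using ij by (simp only: base_gram_index)
  qed (simp_all add: base_gram_dim perm_matrix_def mat_diag_def)
  then have "gram_equivalent k (gram ys) (base_gram \<alpha> k)"
    unfolding gram_equivalent_def Let_def using permutes_id[of "{..<k}"]
    by (intro exI[of _ "\<lambda>i. s (xs ! i)"] exI[of _ id]) (auto simp: s_def)
  then have "k \<in> ?K" using leny ysX by blast
  then show ?thesis unfolding base_size_def kS[symmetric] using Max_ge[OF finK] by blast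
qed

text \<open>Injectivity holds because \<open>X\<close> never contains \<open>x\<close> and \<open>-x\<close> simultaneously, as \<open>\<alpha> < 1\<close>.
So switching loses no vectors.\<close>
lemma equiangular_switch:
  assumes X: "equiangular \<alpha> X" and s: "\<And>x. x \<in> X \<Longrightarrow> s x = x \<or> s x = - x"
  shows "equiangular \<alpha> (s ` X)" "inj_on s X"
proof -
  have unit: "inner x x = 1" if "x \<in> X" for x
    using X that by (auto simp: equiangular_def dot_square_norm)
  have a: "0 \<le> \<alpha>" "\<alpha> < 1" using X by (auto simp: equiangular_def)
  have ang: "inner x y = \<alpha> \<or> inner x y = -\<alpha>" if "x \<in> X" "y \<in> X" "x \<noteq> y" for x y
    using X that by (auto simp: equiangular_def)
  have ang': "inner (s x) (s y) = \<alpha> \<or> inner (s x) (s y) = -\<alpha>" if "x \<in> X" "y \<in> X" "x \<noteq> y" for x y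
    using ang[OF that] s[OF that(1)] s[OF that(2)] by auto
  have "inner (s x) (s x) = 1" if "x \<in> X" for x using s[OF that] unit[OF that] by auto
  then show "inj_on s X"
    using ang' a by (intro inj_onI) fastforce
  show "equiangular \<alpha> (s ` X)"
    unfolding equiangular_def
  proof (intro conjI ballI impI)
    show "finite (s ` X)" using X by (simp add: equiangular_def)
    show "norm x = 1" if "x \<in> s ` X" for x
      using that s X unfolding equiangular_def by (metis imageE norm_minus_cancel)
    show "inner x y \<in> {-\<alpha>, \<alpha>}" if "x \<in> s ` X" "y \<in> s ` X" "x \<noteq> y" for x y
    proof -
      from that obtain x' y' where "x' \<in> X" "y' \<in> X" "x = s x'" "y = s y'" by auto
      then show ?thesis using ang'[of x' y'] that(3) by auto
    qed
  qed (use a in auto)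
qed

lemma equiangularD:
  assumes "equiangular \<alpha> X"
  shows "finite X" "\<And>x. x \<in> X \<Longrightarrow> inner x x = 1"
    "\<And>x y. x \<in> X \<Longrightarrow> y \<in> X \<Longrightarrow> x \<noteq> y \<Longrightarrow> inner x y = \<alpha> \<or> inner x y = -\<alpha>" "0 \<le> \<alpha>" "\<alpha> < 1"
  using assms by (auto simp: equiangular_def dot_square_norm)

lemma equiangular_subset: "equiangular \<alpha> X \<Longrightarrow> Y \<subseteq> X \<Longrightarrow> equiangular \<alpha> Y"
  unfolding equiangular_def by (meson finite_subset subsetD)

lemma num_pos_signs:
  assumes "\<alpha> > 0"
  shows "num_pos (signs \<alpha> ps x) = card {i. i < length ps \<and> inner x (ps ! i) > 0}"
proof -
  have "num_pos (signs \<alpha> ps x) = card {i. i < length (signs \<alpha> ps x) \<and> 0 < signs \<alpha> ps x ! i}"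
    unfolding num_pos_def by (rule length_filter_conv_card)
  also have "{i. i < length (signs \<alpha> ps x) \<and> 0 < signs \<alpha> ps x ! i} = {i. i < length ps \<and> inner x (ps ! i) > 0}"
    using assms by (auto simp: signs_def zero_less_divide_iff)
  finally show ?thesis .
qed

lemma num_pos_signs_minus:
  assumes "\<alpha> > 0" and "\<And>i. i < length ps \<Longrightarrow> inner x (ps ! i) \<noteq> 0"
  shows "num_pos (signs \<alpha> ps (- x)) = length ps - num_pos (signs \<alpha> ps x)"
proof -
  have "{i. i < length ps \<and> inner (- x) (ps ! i) > 0} = {..<length ps} - {i. i < length ps \<and> inner x (ps ! i) > 0}"
    using assms(2) by (force simp: not_less)
  also have "card \<dots> = length ps - card {i. i < length ps \<and> inner x (ps ! i) > 0}"
    by (subst card_Diff_subset) auto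
  finally show ?thesis by (simp add: num_pos_signs[OF assms(1)])
qed

text \<open>Normalization leaves at most two positive signs among five. The two maximality
properties hold since otherwise six vectors with pairwise inner products \<open>-1/5\<close> would exist
up to sign in \<open>X\<close>: either \<open>x\<close> and the whole base, or a triangle \<open>x, y, z\<close> in a pillar and
the three base vectors at its negative positions.\<close>
lemma five_base_maximal_normalized_rest:
  assumes X: "equiangular (1/5) X" and bs: "base_size (1/5) X = 5" and ib: "is_base (1/5) X ps"
  shows "five_base_maximal ((!) ps) (normalized_rest (1/5) X ps)"
    and "card X = card (normalized_rest (1/5) X ps) + 5"
proof -
  let ?N = "normalized_rest (1/5) X ps"
  define X' where "X' = switch_onto (set ps) X"
  have len: "length ps = 5" using ib bs by (simp add: is_base_def)
  have g: "inner (ps ! i) (ps ! j) = (if i = j then 1 else -1/5)" if "i < 5" "j < 5" for i j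
  proof -
    have "gram ps $$ (i, j) = base_gram (1/5) 5 $$ (i, j)" using ib len by (simp add: is_base_def)
    then show ?thesis using that len by (simp add: gram_index base_gram_index)
  qed
  have dist: "distinct ps"
    unfolding distinct_conv_nth
  proof (intro allI impI notI)
    fix i j assume "i < length ps" "j < length ps" "i \<noteq> j" "ps ! i = ps ! j"
    then show False using g[of i i] g[of i j] len by simp
  qed
  have psX: "p \<in> X \<or> - p \<in> X" if "p \<in> set ps" for p
  proof -
    obtain Y s where s: "\<forall>x\<in>X. s x \<in> {x, - x}" "bij_betw s X Y" "set ps \<subseteq> Y"
      using ib unfolding is_base_def switching_equivalent_def by blast
    then have "p \<in> s ` X" using that by (auto simp: bij_betw_def)
    then obtain x where "x \<in> X" "p = s x" by blast
    then show ?thesis using s(1) by auto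
  qed
  have sw: "(if - x \<in> set ps then - x else x) = x \<or> (if - x \<in> set ps then - x else x) = - x" for x by auto
  have X': "equiangular (1/5) X'" and cX': "card X' = card X"
    using equiangular_switch(1)[OF X sw] card_image[OF equiangular_switch(2)[OF X sw]]
    unfolding X'_def switch_onto_def by this
  have X'X: "x \<in> X \<or> - x \<in> X" if "x \<in> X'" for x
    using that by (auto simp: X'_def switch_onto_def)
  have nneg: "- p \<notin> set ps" if p: "p \<in> set ps" for p
  proof
    assume "- p \<in> set ps"
    then obtain j where j: "j < 5" "ps ! j = - p" using len by (auto simp: in_set_conv_nth)
    obtain i where i: "i < 5" "ps ! i = p" using p len by (auto simp: in_set_conv_nth)
    have "inner p p = 1" using g[of i i] i by simp
    moreover have "inner p (- p) = (if i = j then 1 else -1/5)" using g[of i j] i j by simp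
    ultimately show False by (simp split: if_splits)
  qed
  have PX': "set ps \<subseteq> X'"
  proof
    fix p assume p: "p \<in> set ps"
    show "p \<in> X'" using psX[OF p]
    proof
      assume "p \<in> X"
      then show ?thesis unfolding X'_def switch_onto_def using nneg[OF p] by (intro image_eqI[of _ _ p]) auto
    next
      assume "- p \<in> X"
      then show ?thesis unfolding X'_def switch_onto_def using p by (intro image_eqI[of _ _ "- p"]) auto
    qed
  qed
  have R: "equiangular (1/5) (X' - set ps)" using X' by (rule equiangular_subset) auto
  have ns: "normalize_sign (1/5) ps x = x \<or> normalize_sign (1/5) ps x = - x" for x
    by (simp add: normalize_sign_def)
  have N: "?N = normalize_sign (1/5) ps ` (X' - set ps)" by (simp add: normalized_rest_def X'_def)
  have eN: "equiangular (1/5) ?N" and cN: "card ?N = card (X' - set ps)"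
    using equiangular_switch(1)[OF R ns] card_image[OF equiangular_switch(2)[OF R ns]]
    unfolding N by this
  have "card (set ps) = 5" using dist len by (simp add: distinct_card)
  then show "card X = card ?N + 5"
    using cN cX' PX' equiangularD(1)[OF X'] card_mono[OF equiangularD(1)[OF X'] PX']
    by (simp add: card_Diff_subset)
  note eD = equiangularD[OF eN]
  have N_cases: "\<exists>y\<in>X' - set ps. x = y \<or> x = - y" if x: "x \<in> ?N" for x
  proof -
    obtain y where "y \<in> X' - set ps" "x = normalize_sign (1/5) ps y" using x unfolding N by blast
    then show ?thesis using ns[of y] by auto
  qed
  have NX: "x \<in> X \<or> - x \<in> X" if x: "x \<in> ?N" for x
  proof -
    obtain y where "y \<in> X'" "x = y \<or> x = - y" using N_cases[OF x] by blast
    then show ?thesis using X'X[of y] by auto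
  qed
  have R_base: "inner x (ps ! i) = 1/5 \<or> inner x (ps ! i) = -1/5" if "x \<in> X' - set ps" "i < 5" for x i
  proof -
    have "ps ! i \<in> set ps" using that len by simp
    then show ?thesis using equiangularD(3)[OF X', of x "ps ! i"] that PX' by auto
  qed
  have N_base: "inner x (ps ! i) = 1/5 \<or> inner x (ps ! i) = -1/5" if x: "x \<in> ?N" and i: "i < 5" for x i
  proof -
    obtain y where "y \<in> X' - set ps" "x = y \<or> x = - y" using N_cases[OF x] by blast
    then show ?thesis using R_base[of y i] i by auto
  qed
  interpret fb: five_base "(!) ps" ?N
  proof
    show "\<And>i j. i < 5 \<Longrightarrow> j < 5 \<Longrightarrow> inner (ps ! i) (ps ! j) = (if i = j then 1 else -1/5)" by (rule g)
    show "finite ?N" by (rule eD(1))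
    show "\<And>x. x \<in> ?N \<Longrightarrow> inner x x = 1" by (rule eD(2))
    show "\<And>x y. x \<in> ?N \<Longrightarrow> y \<in> ?N \<Longrightarrow> x \<noteq> y \<Longrightarrow> inner x y = 1/5 \<or> inner x y = -1/5"
      using eD(3) by simp
    show "\<And>x i. x \<in> ?N \<Longrightarrow> i < 5 \<Longrightarrow> inner x (ps ! i) = 1/5 \<or> inner x (ps ! i) = -1/5" by (rule N_base)
  qed
  have np: "num_pos (signs (1/5) ps x) = card (fb.pos x)" for x
    by (simp add: num_pos_signs len fb.pos_def)
  have le2: "card (fb.pos x) \<le> 2" if x: "x \<in> ?N" for x
  proof -
    obtain y where y: "y \<in> X' - set ps" "x = normalize_sign (1/5) ps y" using x unfolding N by blast
    have "\<And>i. i < length ps \<Longrightarrow> inner y (ps ! i) \<noteq> 0" using R_base[OF y(1)] len by force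
    then have "num_pos (signs (1/5) ps (- y)) = 5 - num_pos (signs (1/5) ps y)"
      using num_pos_signs_minus[of "1/5" ps y] len by simp
    then have "num_pos (signs (1/5) ps x) \<le> 2"
      unfolding y(2) normalize_sign_def by auto
    then show ?thesis by (simp add: np)
  qed
  \<comment> \<open>six pairwise obtuse vectors contradict \<open>base_size (1/5) X = 5\<close>\<close>
  have no6: False if "finite S" "card S = 6" "\<And>x. x \<in> S \<Longrightarrow> x \<in> X \<or> - x \<in> X"
    "\<And>x y. x \<in> S \<Longrightarrow> y \<in> S \<Longrightarrow> x \<noteq> y \<Longrightarrow> inner x y = -1/5" for S
    using card_le_base_size[OF X that(1,3)] that(2,4) bs by force
  have p_inj: "inj_on ((!) ps) {..<5}" using dist len by (simp add: inj_on_nth)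
  have ge1: "card (fb.pos x) \<noteq> 0" if x: "x \<in> ?N" for x
  proof
    assume "card (fb.pos x) = 0"
    then have neg: "inner x p = -1/5" if "p \<in> set ps" for p
      using that fb.inner_base[OF x] fb.finite_pos[of x] len by (auto simp: in_set_conv_nth)
    have xps: "x \<notin> set ps" using neg[of x] eD(2)[OF x] by auto
    show False
    proof (rule no6[of "insert x (set ps)"])
      show "card (insert x (set ps)) = 6" using xps \<open>card (set ps) = 5\<close> by simp
      show "y \<in> X \<or> - y \<in> X" if "y \<in> insert x (set ps)" for y using that NX[OF x] psX by auto
      show "inner y z = -1/5" if "y \<in> insert x (set ps)" "z \<in> insert x (set ps)" "y \<noteq> z" for y z
      proof -
        have "inner y z = -1/5" if "y \<in> set ps" "z \<in> set ps"
          using that g \<open>y \<noteq> z\<close> len by (auto simp: in_set_conv_nth)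
        moreover have "inner p x = -1/5" if "p \<in> set ps" for p
          using neg[OF that] by (simp add: inner_commute)
        ultimately show ?thesis using that neg by auto
      qed
    qed simp
  qed
  show "five_base_maximal ((!) ps) ?N"
  proof
    fix x assume "x \<in> ?N"
    then show "card (fb.pos x) = 1 \<or> card (fb.pos x) = 2" using le2[of x] ge1[of x] by linarith
  next
    fix x y z assume xyz: "x \<in> ?N" "y \<in> ?N" "z \<in> ?N" and c: "card (fb.pos x) = 2"
      and same: "fb.pos y = fb.pos x" "fb.pos z = fb.pos x"
    show "\<not> (inner x y = -1/5 \<and> inner y z = -1/5 \<and> inner x z = -1/5)"
    proof
      assume t: "inner x y = -1/5 \<and> inner y z = -1/5 \<and> inner x z = -1/5"
      let ?I = "{..<5} - fb.pos x"
      let ?Q = "(!) ps ` ?I"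
      have cQ: "card ?Q = 3"
        using c fb.finite_pos[of x] fb.pos_subset[of x]
        by (subst card_image) (auto intro: inj_on_subset[OF p_inj] simp: card_Diff_subset)
      have neg: "inner w p = -1/5" "inner p w = -1/5" if w: "w \<in> {x, y, z}" and p: "p \<in> ?Q" for w p
      proof -
        obtain i where "i < 5" "i \<notin> fb.pos x" "p = ps ! i" using p by auto
        then show "inner w p = -1/5" using w xyz same fb.inner_base by auto
        then show "inner p w = -1/5" by (simp add: inner_commute)
      qed
      have tri: "inner w w' = -1/5" if "w \<in> {x, y, z}" "w' \<in> {x, y, z}" "w \<noteq> w'" for w w'
        using that t inner_commute[of x y] inner_commute[of y z] inner_commute[of x z] by auto
      have ne: "x \<noteq> y" "y \<noteq> z" "x \<noteq> z" using t eD(2)[OF xyz(1)] eD(2)[OF xyz(2)] by auto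
      have "w \<notin> ?Q" if "w \<in> {x, y, z}" for w
      proof
        assume "w \<in> ?Q"
        then have "inner w w = -1/5" by (rule neg(1)[OF that])
        moreover have "inner w w \<ge> 0" by simp
        ultimately show False by linarith
      qed
      then have disj: "{x, y, z} \<inter> ?Q = {}" by blast
      show False
      proof (rule no6[of "{x, y, z} \<union> ?Q"])
        show "card ({x, y, z} \<union> ?Q) = 6"
          using cQ ne disj by (subst card_Un_disjoint) auto
        show "w \<in> X \<or> - w \<in> X" if "w \<in> {x, y, z} \<union> ?Q" for w
        proof -
          have "?Q \<subseteq> set ps" using len by auto
          then show ?thesis using that NX xyz psX by blast
        qed
        show "inner w w' = -1/5" if w: "w \<in> {x, y, z} \<union> ?Q" "w' \<in> {x, y, z} \<union> ?Q" "w \<noteq> w'" for w w'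
        proof -
          have QQ: "inner w w' = -1/5" if "w \<in> ?Q" "w' \<in> ?Q"
            using that g \<open>w \<noteq> w'\<close> by auto
          show ?thesis
            using w(1)
          proof (rule UnE)
            assume 1: "w \<in> {x, y, z}"
            show ?thesis using w(2) by (rule UnE) (rule tri[OF 1 _ w(3)] neg(1)[OF 1], assumption)+
          next
            assume 2: "w \<in> ?Q"
            show ?thesis using w(2) by (rule UnE) (rule neg(2)[OF _ 2] QQ[OF 2], assumption)+
          qed
        qed
      qed simp
    qed
  qed
qed

text \<open>Within the normalized set a sign vector is determined by its set of positive
positions, so pillars and nonempty fibers are the same sets.\<close>
lemma card_pillars:
  assumes "five_base_maximal ((!) ps) (normalized_rest (1/5) X ps)" and len: "length ps = 5"
  shows "card (pillars (1/5) X ps 2) = card (five_base_maximal.patterns ((!) ps) (normalized_rest (1/5) X ps))"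
proof -
  let ?N = "normalized_rest (1/5) X ps"
  interpret fb: five_base_maximal "(!) ps" ?N by (rule assms)
  have np: "num_pos (signs (1/5) ps x) = card (fb.pos x)" for x
    by (simp add: num_pos_signs len fb.pos_def)
  have same: "signs (1/5) ps x = signs (1/5) ps y \<longleftrightarrow> fb.pos x = fb.pos y" if xy: "x \<in> ?N" "y \<in> ?N" for x y
  proof -
    have "signs (1/5) ps x = signs (1/5) ps y \<longleftrightarrow> (\<forall>i<5. inner x (ps ! i) = inner y (ps ! i))"
      by (simp add: signs_def list_eq_iff_nth_eq len)
    also have "\<dots> \<longleftrightarrow> fb.pos x = fb.pos y"
    proof
      show "fb.pos x = fb.pos y" if "\<forall>i<5. inner x (ps ! i) = inner y (ps ! i)"
        using that by (auto simp: fb.pos_def)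
      show "\<forall>i<5. inner x (ps ! i) = inner y (ps ! i)" if "fb.pos x = fb.pos y"
        using that fb.inner_base[OF xy(1)] fb.inner_base[OF xy(2)] by simp
    qed
    finally show ?thesis .
  qed
  have "pillar (1/5) X ps x = fb.fiber (fb.pos x)" if "x \<in> ?N" for x
    using same[OF _ that] by (auto simp: pillar_def fb.fiber_def)
  then have "pillars (1/5) X ps 2 = fb.fiber ` fb.patterns"
    by (auto simp: pillars_def fb.patterns_def np)
  moreover have "inj_on fb.fiber fb.patterns"
    using fb.patternD(3) by (intro inj_onI) (auto simp: fb.fiber_def)
  ultimately show ?thesis by (simp add: card_image)
qed

section \<open>The bounds\<close>

theorem theorem4p6:
  fixes X :: "(real ^ 'n) set" and ps :: "(real ^ 'n) list"
  assumes "equiangular (1/5) X"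
    and "base_size (1/5) X = 5"
    and "is_base (1/5) X ps"
  shows "(card (pillars (1/5) X ps 2) \<ge> 2 \<longrightarrow> card X \<le> 272) \<and>
         (card (pillars (1/5) X ps 2) \<le> 1 \<longrightarrow> real (card X) \<le> 4/3 * real CARD('n) + 12)"
proof -
  let ?N = "normalized_rest (1/5) X ps"
  note fbm = five_base_maximal_normalized_rest[OF assms]
  interpret fb: five_base_maximal "(!) ps" ?N by (rule fbm(1))
  have len: "length ps = 5" using assms(2,3) by (simp add: is_base_def)
  note cp = card_pillars[OF fbm(1) len]
  have "3 * card S \<le> 4 * CARD('n)" if "simply_laced S" "triangle_free S" for S :: "(real ^ 'n) set"
    using triangle_free_simply_laced_card[OF that] dim_subset_UNIV[of S] by simp
  then have "card fb.patterns \<le> 1 \<Longrightarrow> 3 * card ?N \<le> 4 * CARD('n) + 15"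
    by (rule fb.fiber_card_le_dim)
  then show ?thesis using fb.card_le_267 cp fbm(2) by fastforce
qed

end
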